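(* Let $T$ be a complete (continuous) $L$-theory, $\phi(x,y)$ an $L$-formula, and $\mathcal U$ the monster model of $T$. Then the following are equivalent: (i) $\phi(x,y)$ has $NIP$ for $T$. (ii) The independence property is semi-uniformly blocked for $\phi(x,y)$. (iii) For any sequence (not necessarily indiscernible) $(a_i:i<\omega)$ of $|x|$-tuples in $\mathcal U$, there exists a subsequence $(a_{j_i}:i<\omega)$ such that, for each $b\in\mathcal U$, the sequence $\phi(a_{j_i},b)$ converges. (iv) For any sequence (not necessarily indiscernible) $(a_i:i<\omega)$ of $|x|$-tuples in $\mathcal U$, there exists a subsequence $(a_{j_i}:i<\omega)$ such that the sequence $\phi(a_{j_i},y)$ converges pointwise to a function $f$ that is Baire-1/2. (v) There is no sequence $(a_i)_{i<\omega}$ in $\mathcal U$ such that the sequence $(\phi(a_i,y):S_{\tilde\phi}(\mathcal U)\to[0,1])$ is equivalent in the supremum norm to the usual basis of $\ell_1$.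
   Context: Continuous first-order logic is that of Ben Yaacov–Berenstein–Henson–Usvyatsov: formulas are $[0,1]$-valued, with value $0$ interpreted as "true". Variables $x,y$ denote finite tuples. Quantified statements are evaluated in $\mathcal U$. $\phi(x,y)$ has $IP$ if there are real numbers $r<s$ and a sequence $(a_i:i<\omega)$ in $\mathcal U$ such that for all disjoint finite sets $E,F\subseteq\omega$: $\exists y\big(\bigwedge_{i\in E}\phi(a_i,y)\le r\wedge\bigwedge_{i\in F}\phi(a_i,y)\ge s\big)$. It has $NIP$ if it does not have $IP$. The independence property is semi-uniformly blocked for $\phi(x,y)$ if for each $r<s$ there are a natural number $N_{r,s}$ and a set $E\subset\{1,\dots,N_{r,s}\}$ such that for every sequence $(a_i)$ in $\mathcal U$ and all $i_1<\dots<i_{N_{r,s}}<\omega$ the following does not hold: $$\exists y\Big(\bigwedge_{j\in E}\phi(a_{i_j},y)\le r\wedge\bigwedge_{j\in\{1,\dots,N_{r,s}\}\setminus E}\phi(a_{i_j},y)\ge s\Big).$$ Put $\tilde\phi(y,x)=\phi(x,y)$. For a parameter set $A$, $S_{\tilde\phi}(A)$ is the set of complete $\tilde\phi$-types over $A$, i.e. functions $a\mapsto\phi(a,b)$ ($a$ ranging over $|x|$-tuples from $A$) with $b$ in an elementary extension, with the weakest topology making evaluation at each $a$ continuous; it is compact Hausdorff. Each $\phi(a,y)$ is regarded as the continuous function $q\mapsto\phi(a,q)$ on $S_{\tilde\phi}(A)$. In (iv) the functions may be regarded as defined on the compact metrizable space $S_{\tilde\phi}(\{a_i:i<\omega\})$.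 For a compact metric space $X$: $DBSC(X)$ is the set of real-valued functions $F_1-F_2$ with $F_1,F_2$ bounded semi-continuous on $X$; $f:X\to\mathbb R$ is Baire-1/2 ($f\in B_{1/2}(X)$) if it is the uniform limit of a sequence from $DBSC(X)$. A sequence $(f_i)$ in a normed space is equivalent to a sequence $(e_i)$ if there are constants $c,C>0$ with $c\|\sum_{i\le k}t_ie_i\|\le\|\sum_{i\le k}t_if_i\|\le C\|\sum_{i\le k}t_ie_i\|$ for all $k$ and all scalars $t_1,\dots,t_k$.
   Formalization: In (ii), "for all i_1<...<i_N the following does not hold" is corrected to "for every sequence (a_i), it does not hold for all i_1<...<i_N" (some increasing tuple fails the pattern); as written, (i)=>(ii) fails for x<y in dense linear orders. *)

theory Defs
  imports "HOL-Analysis.Analysis"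
begin

section \<open>Continuous first-order logic\<close>

text \<open>
  One-sorted continuous logic of Ben Yaacov, Berenstein, Henson and Usvyatsov, with metrics of
  diameter at most 1 and \<open>[0,1]\<close>-valued predicates; the value 0 means true. The symbols
  of a language are the members of \<open>fsyms\<close> and \<open>psyms\<close> (so either set may be empty); each has an
  arity and a modulus of uniform continuity.
\<close>

record ('f, 'p) lang =
  fsyms :: "'f set"
  psyms :: "'p set"
  farity :: "'f \<Rightarrow> nat"
  parity :: "'p \<Rightarrow> nat"
  fmod :: "'f \<Rightarrow> real \<Rightarrow> real"
  pmod :: "'p \<Rightarrow> real \<Rightarrow> real"

definition is_language :: "('f, 'p) lang \<Rightarrow> bool" where
  "is_language L \<longleftrightarrow>
     (\<forall>f\<in>fsyms L. \<forall>e\<in>{0<..1}. fmod L f e \<in> {0<..1}) \<and>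
     (\<forall>p\<in>psyms L. \<forall>e\<in>{0<..1}. pmod L p e \<in> {0<..1})"

datatype 'f tm = Var nat | App 'f "'f tm list"

datatype ('f, 'p) fm =
    Dist "'f tm" "'f tm"
  | Pred 'p "'f tm list"
  | Conn "(nat \<Rightarrow> real) \<Rightarrow> real" "('f, 'p) fm list"
  | SupQ nat "('f, 'p) fm"
  | InfQ nat "('f, 'p) fm"

text \<open>
  Every continuous function \<open>[0,1]^n \<rightarrow> [0,1]\<close> is a connective. A point of \<open>[0,1]^n\<close> is encoded as
  a function on \<open>nat\<close> that vanishes from \<open>n\<close> on, so that the product topology of
  \<open>nat \<Rightarrow> real\<close> induces the usual topology on \<open>cube n\<close>.
\<close>

definition cube :: "nat \<Rightarrow> (nat \<Rightarrow> real) set" where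
  "cube n = {v. (\<forall>i<n. v i \<in> {0..1}) \<and> (\<forall>i\<ge>n. v i = 0)}"

definition vec_of :: "real list \<Rightarrow> nat \<Rightarrow> real" where
  "vec_of rs = (\<lambda>i. if i < length rs then rs ! i else 0)"

fun fv_tm :: "'f tm \<Rightarrow> nat set" where
  "fv_tm (Var v) = {v}"
| "fv_tm (App f ts) = (\<Union>t\<in>set ts. fv_tm t)"

fun fv :: "('f, 'p) fm \<Rightarrow> nat set" where
  "fv (Dist t u) = fv_tm t \<union> fv_tm u"
| "fv (Pred p ts) = (\<Union>t\<in>set ts. fv_tm t)"
| "fv (Conn c \<phi>s) = (\<Union>\<phi>\<in>set \<phi>s. fv \<phi>)"
| "fv (SupQ v \<phi>) = fv \<phi> - {v}"
| "fv (InfQ v \<phi>) = fv \<phi> - {v}"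

fun wf_tm :: "('f, 'p) lang \<Rightarrow> 'f tm \<Rightarrow> bool" where
  "wf_tm L (Var v) \<longleftrightarrow> True"
| "wf_tm L (App f ts) \<longleftrightarrow> f \<in> fsyms L \<and> length ts = farity L f \<and> (\<forall>t\<in>set ts. wf_tm L t)"

fun wf_fm :: "('f, 'p) lang \<Rightarrow> ('f, 'p) fm \<Rightarrow> bool" where
  "wf_fm L (Dist t u) \<longleftrightarrow> wf_tm L t \<and> wf_tm L u"
| "wf_fm L (Pred p ts) \<longleftrightarrow> p \<in> psyms L \<and> length ts = parity L p \<and> (\<forall>t\<in>set ts. wf_tm L t)"
| "wf_fm L (Conn c \<phi>s) \<longleftrightarrow>
     continuous_on (cube (length \<phi>s)) c \<and> c ` cube (length \<phi>s) \<subseteq> {0..1} \<and>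
     (\<forall>\<phi>\<in>set \<phi>s. wf_fm L \<phi>)"
| "wf_fm L (SupQ v \<phi>) \<longleftrightarrow> wf_fm L \<phi>"
| "wf_fm L (InfQ v \<phi>) \<longleftrightarrow> wf_fm L \<phi>"

record ('f, 'p, 'u) mstruct =
  univ :: "'u set"
  mdist :: "'u \<Rightarrow> 'u \<Rightarrow> real"
  fint :: "'f \<Rightarrow> 'u list \<Rightarrow> 'u"
  pint :: "'p \<Rightarrow> 'u list \<Rightarrow> real"

definition tuples :: "nat \<Rightarrow> 'u set \<Rightarrow> 'u list set" where
  "tuples n A = {a. length a = n \<and> set a \<subseteq> A}"

text \<open>Tuples are compared in the maximum metric; \<open>close_tuples\<close> says that it is below \<open>\<delta>\<close>.\<close>

definition close_tuples ::
    "('f, 'p, 'u) mstruct \<Rightarrow> real \<Rightarrow> 'u list \<Rightarrow> 'u list \<Rightarrow> bool" where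
  "close_tuples M \<delta> a b \<longleftrightarrow> list_all2 (\<lambda>x y. mdist M x y < \<delta>) a b"

definition is_structure :: "('f, 'p) lang \<Rightarrow> ('f, 'p, 'u) mstruct \<Rightarrow> bool" where
  "is_structure L M \<longleftrightarrow>
     univ M \<noteq> {} \<and>
     Metric_space (univ M) (mdist M) \<and>
     Metric_space.mcomplete (univ M) (mdist M) \<and>
     (\<forall>x\<in>univ M. \<forall>y\<in>univ M. mdist M x y \<le> 1) \<and>
     (\<forall>f\<in>fsyms L. \<forall>a\<in>tuples (farity L f) (univ M). fint M f a \<in> univ M) \<and>
     (\<forall>f\<in>fsyms L. \<forall>e\<in>{0<..1}.
        \<forall>a\<in>tuples (farity L f) (univ M). \<forall>b\<in>tuples (farity L f) (univ M).
          close_tuples M (fmod L f e) a b \<longrightarrow> mdist M (fint M f a) (fint M f b) \<le> e) \<and>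
     (\<forall>p\<in>psyms L. \<forall>a\<in>tuples (parity L p) (univ M). pint M p a \<in> {0..1}) \<and>
     (\<forall>p\<in>psyms L. \<forall>e\<in>{0<..1}.
        \<forall>a\<in>tuples (parity L p) (univ M). \<forall>b\<in>tuples (parity L p) (univ M).
          close_tuples M (pmod L p e) a b \<longrightarrow> \<bar>pint M p a - pint M p b\<bar> \<le> e)"

fun teval :: "('f, 'p, 'u) mstruct \<Rightarrow> (nat \<Rightarrow> 'u) \<Rightarrow> 'f tm \<Rightarrow> 'u" where
  "teval M s (Var v) = s v"
| "teval M s (App f ts) = fint M f (map (teval M s) ts)"

fun eval :: "('f, 'p, 'u) mstruct \<Rightarrow> (nat \<Rightarrow> 'u) \<Rightarrow> ('f, 'p) fm \<Rightarrow> real" where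
  "eval M s (Dist t u) = mdist M (teval M s t) (teval M s u)"
| "eval M s (Pred p ts) = pint M p (map (teval M s) ts)"
| "eval M s (Conn c \<phi>s) = c (vec_of (map (eval M s) \<phi>s))"
| "eval M s (SupQ v \<phi>) = (SUP m\<in>univ M. eval M (s(v := m)) \<phi>)"
| "eval M s (InfQ v \<phi>) = (INF m\<in>univ M. eval M (s(v := m)) \<phi>)"

text \<open>A theory is a set of sentences; a member \<open>\<sigma>\<close> stands for the closed condition \<open>\<sigma> = 0\<close>.\<close>

definition Th :: "('f, 'p) lang \<Rightarrow> ('f, 'p, 'u) mstruct \<Rightarrow> ('f, 'p) fm set" where
  "Th L M = {\<sigma>. wf_fm L \<sigma> \<and> fv \<sigma> = {} \<and> (\<forall>s. eval M s \<sigma> = 0)}"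

text \<open>
  A theory is complete if it is the theory of some structure. The type of that structure is a
  parameter: a theorem assuming \<open>complete_theory TYPE('m) L T\<close> holds for every type \<open>'m\<close>.
\<close>

definition complete_theory :: "'m itself \<Rightarrow> ('f, 'p) lang \<Rightarrow> ('f, 'p) fm set \<Rightarrow> bool" where
  "complete_theory _ L T \<longleftrightarrow> (\<exists>M :: ('f, 'p, 'm) mstruct. is_structure L M \<and> T = Th L M)"

definition is_model ::
    "('f, 'p) lang \<Rightarrow> ('f, 'p) fm set \<Rightarrow> ('f, 'p, 'u) mstruct \<Rightarrow> bool" where
  "is_model L T M \<longleftrightarrow> is_structure L M \<and> T \<subseteq> Th L M"

section \<open>The monster model\<close>

definition elementary_map ::
    "('f, 'p) lang \<Rightarrow> ('f, 'p, 'u) mstruct \<Rightarrow> ('f, 'p, 'v) mstruct \<Rightarrow> 'u set \<Rightarrow> ('u \<Rightarrow> 'v) \<Rightarrow> bool" where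
  "elementary_map L M N A h \<longleftrightarrow>
     h ` A \<subseteq> univ N \<and>
     (\<forall>\<phi> s. wf_fm L \<phi> \<longrightarrow> (\<forall>v\<in>fv \<phi>. s v \<in> A) \<longrightarrow> eval N (h \<circ> s) \<phi> = eval M s \<phi>)"

definition automorphism :: "('f, 'p) lang \<Rightarrow> ('f, 'p, 'u) mstruct \<Rightarrow> ('u \<Rightarrow> 'u) \<Rightarrow> bool" where
  "automorphism L M g \<longleftrightarrow>
     bij_betw g (univ M) (univ M) \<and>
     (\<forall>x\<in>univ M. \<forall>y\<in>univ M. mdist M (g x) (g y) = mdist M x y) \<and>
     (\<forall>f\<in>fsyms L. \<forall>a\<in>tuples (farity L f) (univ M). fint M f (map g a) = g (fint M f a)) \<and>
     (\<forall>p\<in>psyms L. \<forall>a\<in>tuples (parity L p) (univ M). pint M p (map g a) = pint M p a)"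

text \<open>
  A condition with parameters is a pair \<open>(\<phi>, e)\<close>: the unknowns are the variables in \<open>X\<close>, and any other
  free variable \<open>v\<close> of \<open>\<phi>\<close> stands for the parameter \<open>e v\<close>. The condition is \<open>\<phi> = 0\<close>.
\<close>

definition satisfied_in ::
    "('f, 'p, 'u) mstruct \<Rightarrow> nat set \<Rightarrow> (('f, 'p) fm \<times> (nat \<Rightarrow> 'u)) set \<Rightarrow> bool" where
  "satisfied_in M X \<Gamma> \<longleftrightarrow>
     (\<exists>s. s ` X \<subseteq> univ M \<and> (\<forall>(\<phi>, e)\<in>\<Gamma>. eval M (override_on e s X) \<phi> = 0))"

context
  includes cardinal_syntax
begin

definition saturated :: "('f, 'p) lang \<Rightarrow> 'k rel \<Rightarrow> ('f, 'p, 'u) mstruct \<Rightarrow> bool" where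
  "saturated L \<kappa> M \<longleftrightarrow>
     (\<forall>A X \<Gamma>. A \<subseteq> univ M \<longrightarrow> |A| <o \<kappa> \<longrightarrow> finite X \<longrightarrow>
        (\<forall>(\<phi>, e)\<in>\<Gamma>. wf_fm L \<phi> \<and> (\<forall>v\<in>fv \<phi> - X. e v \<in> A)) \<longrightarrow>
        (\<forall>\<Gamma>0\<subseteq>\<Gamma>. finite \<Gamma>0 \<longrightarrow> satisfied_in M X \<Gamma>0) \<longrightarrow>
        satisfied_in M X \<Gamma>)"

definition strongly_homogeneous :: "('f, 'p) lang \<Rightarrow> 'k rel \<Rightarrow> ('f, 'p, 'u) mstruct \<Rightarrow> bool" where
  "strongly_homogeneous L \<kappa> M \<longleftrightarrow>
     (\<forall>A h. A \<subseteq> univ M \<longrightarrow> |A| <o \<kappa> \<longrightarrow> elementary_map L M M A h \<longrightarrow>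
        (\<exists>g. automorphism L M g \<and> (\<forall>a\<in>A. g a = h a)))"

definition monster_model ::
    "('f, 'p) lang \<Rightarrow> ('f, 'p) fm set \<Rightarrow> 'k rel \<Rightarrow> ('f, 'p, 'u) mstruct \<Rightarrow> bool" where
  "monster_model L T \<kappa> U \<longleftrightarrow>
     Card_order \<kappa> \<and> natLeq <o \<kappa> \<and> |fsyms L| <o \<kappa> \<and> |psyms L| <o \<kappa> \<and>
     is_model L T U \<and> saturated L \<kappa> U \<and> strongly_homogeneous L \<kappa> U"

end

section \<open>Partitioned formulas and the independence property\<close>

definition partitioned_formula ::
    "('f, 'p) lang \<Rightarrow> ('f, 'p) fm \<Rightarrow> nat list \<Rightarrow> nat list \<Rightarrow> bool" where
  "partitioned_formula L \<phi> x y \<longleftrightarrow> wf_fm L \<phi> \<and> distinct (x @ y) \<and> fv \<phi> \<subseteq> set (x @ y)"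

definition fm_val ::
    "('f, 'p, 'u) mstruct \<Rightarrow> ('f, 'p) fm \<Rightarrow> nat list \<Rightarrow> nat list \<Rightarrow> 'u list \<Rightarrow> 'u list \<Rightarrow> real" where
  "fm_val M \<phi> x y a b = eval M (\<lambda>v. the (map_of (zip (x @ y) (a @ b)) v)) \<phi>"

definition IP :: "('f, 'p, 'u) mstruct \<Rightarrow> ('f, 'p) fm \<Rightarrow> nat list \<Rightarrow> nat list \<Rightarrow> bool" where
  "IP U \<phi> x y \<longleftrightarrow>
     (\<exists>r s. r < s \<and>
       (\<exists>a :: nat \<Rightarrow> 'u list. (\<forall>i. a i \<in> tuples (length x) (univ U)) \<and>
         (\<forall>E F. finite E \<and> finite F \<and> E \<inter> F = {} \<longrightarrow>
           (\<exists>b\<in>tuples (length y) (univ U).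
              (\<forall>i\<in>E. fm_val U \<phi> x y (a i) b \<le> r) \<and> (\<forall>i\<in>F. fm_val U \<phi> x y (a i) b \<ge> s)))))"

definition NIP :: "('f, 'p, 'u) mstruct \<Rightarrow> ('f, 'p) fm \<Rightarrow> nat list \<Rightarrow> nat list \<Rightarrow> bool" where
  "NIP U \<phi> x y \<longleftrightarrow> \<not> IP U \<phi> x y"

text \<open>
  The instance of the independence property of a sequence at \<open>(N, E)\<close> says that the pattern \<open>E\<close> is
  realized along every increasing \<open>N\<close>-tuple of indices. It is blocked if this fails, so the negation
  stands outside the quantifier over the indices. Asking instead that no increasing tuple of any
  sequence realize the pattern would be too strong, even for NIP formulas: for \<open>x < y\<close> in a dense
  linear order every pattern is realized by a sequence listing small and large elements accordingly.
\<close>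

definition semi_uniformly_blocked ::
    "('f, 'p, 'u) mstruct \<Rightarrow> ('f, 'p) fm \<Rightarrow> nat list \<Rightarrow> nat list \<Rightarrow> bool" where
  "semi_uniformly_blocked U \<phi> x y \<longleftrightarrow>
     (\<forall>r s. r < s \<longrightarrow>
       (\<exists>N E. E \<subseteq> {1..N} \<and>
         (\<forall>a :: nat \<Rightarrow> 'u list. (\<forall>i. a i \<in> tuples (length x) (univ U)) \<longrightarrow>
           \<not> (\<forall>i :: nat \<Rightarrow> nat. strict_mono_on {1..N} i \<longrightarrow>
               (\<exists>b\<in>tuples (length y) (univ U).
                  (\<forall>j\<in>E. fm_val U \<phi> x y (a (i j)) b \<le> r) \<and>
                  (\<forall>j\<in>{1..N} - E. fm_val U \<phi> x y (a (i j)) b \<ge> s))))))"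

section \<open>Local type spaces\<close>

text \<open>
  A complete \<open>\<phi>\<close>-type over \<open>A\<close> in the variables \<open>y\<close> is the map \<open>a \<mapsto> \<phi>(a,b)\<close> on the tuples from \<open>A\<close>,
  for some \<open>b\<close> in an elementary extension of \<open>U\<close>. By the downward Loewenheim-Skolem theorem each
  type is realized in an extension of density character at most that of \<open>U\<close> plus the number of symbols plus
  \<open>aleph_0\<close>; the \<open>aleph_0\<close>-th power of this sum bounds the cardinality, so extensions
  carried by subsets of \<open>ext_carrier\<close> suffice. Extensions are taken up to the embedding \<open>h\<close>.
\<close>

type_synonym ('f, 'p, 'u) ext_carrier = "nat \<Rightarrow> 'u + 'f + 'p + nat"

definition local_types ::
    "('f, 'p) lang \<Rightarrow> ('f, 'p, 'u) mstruct \<Rightarrow> ('f, 'p) fm \<Rightarrow> nat list \<Rightarrow> nat list \<Rightarrow> 'u set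
      \<Rightarrow> ('u list \<Rightarrow> real) set" where
  "local_types L U \<phi> x y A =
     {(\<lambda>a\<in>tuples (length x) A. fm_val N \<phi> x y (map h a) b) |
        (N :: ('f, 'p, ('f, 'p, 'u) ext_carrier) mstruct) h b.
        is_structure L N \<and> elementary_map L U N (univ U) h \<and> b \<in> tuples (length y) (univ N)}"

definition type_space ::
    "('f, 'p) lang \<Rightarrow> ('f, 'p, 'u) mstruct \<Rightarrow> ('f, 'p) fm \<Rightarrow> nat list \<Rightarrow> nat list \<Rightarrow> 'u set
      \<Rightarrow> ('u list \<Rightarrow> real) topology" where
  "type_space L U \<phi> x y A =
     subtopology (product_topology (\<lambda>_. euclideanreal) (tuples (length x) A))
       (local_types L U \<phi> x y A)"

section \<open>Baire-1/2 functions\<close>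

definition semicontinuous :: "'a topology \<Rightarrow> ('a \<Rightarrow> real) \<Rightarrow> bool" where
  "semicontinuous X F \<longleftrightarrow>
     (\<forall>t. openin X {x \<in> topspace X. F x < t}) \<or> (\<forall>t. openin X {x \<in> topspace X. F x > t})"

definition DBSC :: "'a topology \<Rightarrow> ('a \<Rightarrow> real) set" where
  "DBSC X = {g. \<exists>F1 F2.
     semicontinuous X F1 \<and> bounded (F1 ` topspace X) \<and>
     semicontinuous X F2 \<and> bounded (F2 ` topspace X) \<and>
     (\<forall>x\<in>topspace X. g x = F1 x - F2 x)}"

definition Baire_half :: "'a topology \<Rightarrow> ('a \<Rightarrow> real) \<Rightarrow> bool" where
  "Baire_half X f \<longleftrightarrow>
     (\<exists>g :: nat \<Rightarrow> 'a \<Rightarrow> real. (\<forall>n. g n \<in> DBSC X) \<and> uniform_limit (topspace X) g f sequentially)"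

section \<open>Equivalence of sequences in normed spaces\<close>

text \<open>
  The normed spaces are spaces of real-valued functions, given by their norms \<open>nf\<close> and \<open>ne\<close>. Only
  values of the norms at linear combinations of the two sequences matter.
\<close>

definition equivalent_seqs ::
    "(('a \<Rightarrow> real) \<Rightarrow> real) \<Rightarrow> (nat \<Rightarrow> 'a \<Rightarrow> real) \<Rightarrow>
     (('b \<Rightarrow> real) \<Rightarrow> real) \<Rightarrow> (nat \<Rightarrow> 'b \<Rightarrow> real) \<Rightarrow> bool" where
  "equivalent_seqs nf f ne e \<longleftrightarrow>
     (\<exists>c C. c > 0 \<and> C > 0 \<and>
       (\<forall>(k::nat) (t :: nat \<Rightarrow> real).
          c * ne (\<lambda>z. \<Sum>i\<le>k. t i * e i z) \<le> nf (\<lambda>z. \<Sum>i\<le>k. t i * f i z) \<and>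
          nf (\<lambda>z. \<Sum>i\<le>k. t i * f i z) \<le> C * ne (\<lambda>z. \<Sum>i\<le>k. t i * e i z)))"

definition sup_norm :: "'a topology \<Rightarrow> ('a \<Rightarrow> real) \<Rightarrow> real" where
  "sup_norm X f = (SUP x\<in>topspace X. \<bar>f x\<bar>)"

definition l1_norm :: "(nat \<Rightarrow> real) \<Rightarrow> real" where
  "l1_norm z = (\<Sum>n. \<bar>z n\<bar>)"

definition l1_basis :: "nat \<Rightarrow> nat \<Rightarrow> real" where
  "l1_basis i = (\<lambda>n. if n = i then 1 else 0)"

end

theory Submission
  imports Defs "HOL-Library.Ramsey" "HOL-Library.Diagonal_Subsequence"
begin

text \<open>
  Everything turns on how often the values \<open>\<phi>(a\<^sub>i, b)\<close> along a sequence \<open>(a\<^sub>i)\<close> can pass back and forth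
  between two levels \<open>r < s\<close>. For a single \<open>b\<close> this happens infinitely often, for some pair of levels,
  exactly if the sequence of values diverges; under NIP one can pass to a subsequence on which the
  number of alternations between \<open>r\<close> and \<open>s\<close> is bounded uniformly in \<open>b\<close>, for every pair of levels
  (\<open>bounded_alternation\<close>).

  For this, suppose that for every length some sequence shows the pattern high, low, high, \<open>\<dots>\<close> of that
  length along all increasing indices. Thinning out such a sequence shatters arbitrarily large finite
  sets, and by compactness an infinite sequence, which is the independence property
  (\<open>NIP_imp_alternation_blocked\<close>). So under NIP some length \<open>N\<close> serves all sequences; this is semi-uniform
  blocking, with the even numbers as the set \<open>E\<close>. By Ramsey's theorem each sequence has a subsequence
  on which the pattern of length \<open>N\<close> never occurs, and a diagonal argument takes care of all levels
  (\<open>subseq_bounded_alternation\<close>).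

  Bounded alternation has three consequences. The sequence converges pointwise
  (\<open>convergent_if_not_alternating\<close>). Its limit is Baire-1/2: the sets of types with at least \<open>m\<close>
  alternations are open and, for fixed levels, only finitely many of them are nonempty, so that the
  indicator of the types which end high is a finite alternating sum of indicators of open sets;
  its average over a fine grid of levels approximates the limit uniformly (\<open>Baire_half_limit\<close>).
  Finally each large increment of the sequence is a crossing of one of finitely many pairs of levels,
  so averages of increments are uniformly small, which is impossible for a copy of the basis of \<open>\<ell>\<^sub>1\<close>
  (\<open>bounded_alternation_imp_not_l1\<close>).

  Conversely, a sequence that witnesses the independence property realizes every pattern. This
  contradicts blocking at once; by compactness an infinite alternating pattern occurs along any
  subsequence, which therefore diverges at some element (\<open>IP_imp_divergent_subseqs\<close>); and an element
  adapted to the signs of the coefficients makes a linear combination large, so that the sequence is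
  equivalent to the basis of \<open>\<ell>\<^sub>1\<close> (\<open>IP_imp_l1_sequence\<close>).

  Compactness enters twice: in finding shattered sequences, that is infinitely many tuples at a time, and
  in realizing by an element of the monster model the values of a type on a sequence of tuples, so
  that bounds on alternations pass to the type spaces. Both follow from \<open>countable_saturation\<close>, which
  extends saturation to countably many unknowns.
\<close>

section \<open>Evaluation of formulas\<close>

lemma teval_in_univ:
  assumes "is_structure L M" and "range s \<subseteq> univ M" and "wf_tm L t"
  shows "teval M s t \<in> univ M"
  using assms(3)
proof (induction t)
  case (Var v)
  then show ?case using assms(2) by auto
next
  case (App f ts)
  then have "map (teval M s) ts \<in> tuples (farity L f) (univ M)"
    by (auto simp: tuples_def)
  then show ?case using assms(1) App.prems by (auto simp: is_structure_def)
qed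

lemma vec_of_in_cube: "set rs \<subseteq> {0..1} \<Longrightarrow> vec_of rs \<in> cube (length rs)"
  by (auto simp: vec_of_def cube_def subset_iff)

lemma eval_in_unit:
  assumes M: "is_structure L M" and "wf_fm L \<phi>" and "range s \<subseteq> univ M"
  shows "eval M s \<phi> \<in> {0..1}"
  using assms(2,3)
proof (induction \<phi> arbitrary: s)
  case (Dist t u)
  interpret Metric_space "univ M" "mdist M" using M by (simp add: is_structure_def)
  have "teval M s t \<in> univ M" "teval M s u \<in> univ M"
    using Dist teval_in_univ[OF M] by auto
  then show ?case using M by (auto simp: is_structure_def)
next
  case (Pred p ts)
  then have "map (teval M s) ts \<in> tuples (parity L p) (univ M)"
    using teval_in_univ[OF M] by (auto simp: tuples_def)
  then show ?case using M Pred.prems by (auto simp: is_structure_def)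
next
  case (Conn c \<phi>s)
  have "eval M s \<psi> \<in> {0..1}" if "\<psi> \<in> set \<phi>s" for \<psi>
    using that Conn.prems by (intro Conn.IH) auto
  then have "set (map (eval M s) \<phi>s) \<subseteq> {0..1}" by (simp add: image_subset_iff)
  then have "vec_of (map (eval M s) \<phi>s) \<in> cube (length \<phi>s)"
    using vec_of_in_cube by (metis length_map)
  moreover have "c ` cube (length \<phi>s) \<subseteq> {0..1}" using Conn.prems by simp
  ultimately show ?case unfolding eval.simps by blast
next
  case (SupQ v \<phi>)
  have ne: "univ M \<noteq> {}" using M by (simp add: is_structure_def)
  have "eval M (s(v := m)) \<phi> \<in> {0..1}" if "m \<in> univ M" for m
    using SupQ.prems that by (intro SupQ.IH) auto
  then have "bdd_above ((\<lambda>m. eval M (s(v := m)) \<phi>) ` univ M)"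
    and lo: "\<And>m. m \<in> univ M \<Longrightarrow> 0 \<le> eval M (s(v := m)) \<phi>"
    and hi: "\<And>m. m \<in> univ M \<Longrightarrow> eval M (s(v := m)) \<phi> \<le> 1" by (auto intro: bdd_aboveI2[where M = 1])
  moreover obtain u where "u \<in> univ M" using ne by auto
  ultimately have "0 \<le> (SUP m\<in>univ M. eval M (s(v := m)) \<phi>)"
    by (intro cSUP_upper2[of _ _ u]) auto
  then show ?case using ne hi by (auto intro: cSUP_least)
next
  case (InfQ v \<phi>)
  have ne: "univ M \<noteq> {}" using M by (simp add: is_structure_def)
  have "eval M (s(v := m)) \<phi> \<in> {0..1}" if "m \<in> univ M" for m
    using InfQ.prems that by (intro InfQ.IH) auto
  then have "bdd_below ((\<lambda>m. eval M (s(v := m)) \<phi>) ` univ M)"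
    and lo: "\<And>m. m \<in> univ M \<Longrightarrow> 0 \<le> eval M (s(v := m)) \<phi>"
    and hi: "\<And>m. m \<in> univ M \<Longrightarrow> eval M (s(v := m)) \<phi> \<le> 1" by (auto intro: bdd_belowI2[where m = 0])
  moreover obtain u where "u \<in> univ M" using ne by auto
  ultimately have "(INF m\<in>univ M. eval M (s(v := m)) \<phi>) \<le> 1"
    by (intro cINF_lower2[of _ _ u]) auto
  then show ?case using ne lo by (auto intro: cINF_greatest)
qed

lemma finite_fv_tm: "finite (fv_tm t)"
  by (induction t) auto

lemma finite_fv: "finite (fv \<phi>)"
  by (induction \<phi>) (auto simp: finite_fv_tm)

lemma teval_cong: "(\<And>v. v \<in> fv_tm t \<Longrightarrow> s v = s' v) \<Longrightarrow> teval M s t = teval M s' t"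
proof (induction t)
  case (App f ts)
  then have "map (teval M s) ts = map (teval M s') ts" by auto
  then show ?case by (simp only: teval.simps)
qed simp

lemma eval_cong: "(\<And>v. v \<in> fv \<phi> \<Longrightarrow> s v = s' v) \<Longrightarrow> eval M s \<phi> = eval M s' \<phi>"
proof (induction \<phi> arbitrary: s s')
  case (Dist t u)
  then have "teval M s t = teval M s' t" "teval M s u = teval M s' u"
    using Dist by (simp_all add: teval_cong[of t s s' M] teval_cong[of u s s' M])
  then show ?case by simp
next
  case (Pred p ts)
  then have "map (teval M s) ts = map (teval M s') ts"
    by (intro map_cong refl teval_cong) auto
  then show ?case by (simp only: eval.simps)
next
  case (Conn c \<phi>s)
  then have "map (eval M s) \<phi>s = map (eval M s') \<phi>s"
    by (intro map_cong refl Conn.IH Conn.prems) auto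
  then show ?case by (simp only: eval.simps)
next
  case (SupQ v \<phi>)
  then have "eval M (s(v := m)) \<phi> = eval M (s'(v := m)) \<phi>" for m
    by (intro SupQ.IH) auto
  then show ?case by simp
next
  case (InfQ v \<phi>)
  then have "eval M (s(v := m)) \<phi> = eval M (s'(v := m)) \<phi>" for m
    by (intro InfQ.IH) auto
  then show ?case by simp
qed

text \<open>
  Bound variables are renamed along with the free ones: for an injective renaming no variable is
  captured, and evaluation commutes with the renaming.
\<close>

fun rename_tm :: "(nat \<Rightarrow> nat) \<Rightarrow> 'f tm \<Rightarrow> 'f tm" where
  "rename_tm \<rho> (Var v) = Var (\<rho> v)"
| "rename_tm \<rho> (App f ts) = App f (map (rename_tm \<rho>) ts)"

fun rename :: "(nat \<Rightarrow> nat) \<Rightarrow> ('f, 'p) fm \<Rightarrow> ('f, 'p) fm" where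
  "rename \<rho> (Dist t u) = Dist (rename_tm \<rho> t) (rename_tm \<rho> u)"
| "rename \<rho> (Pred p ts) = Pred p (map (rename_tm \<rho>) ts)"
| "rename \<rho> (Conn c \<phi>s) = Conn c (map (rename \<rho>) \<phi>s)"
| "rename \<rho> (SupQ v \<phi>) = SupQ (\<rho> v) (rename \<rho> \<phi>)"
| "rename \<rho> (InfQ v \<phi>) = InfQ (\<rho> v) (rename \<rho> \<phi>)"

lemma wf_rename_tm: "wf_tm L t \<Longrightarrow> wf_tm L (rename_tm \<rho> t)"
  by (induction t) auto

lemma wf_rename: "wf_fm L \<phi> \<Longrightarrow> wf_fm L (rename \<rho> \<phi>)"
  by (induction \<phi>) (auto simp: wf_rename_tm)

lemma teval_rename: "teval M s (rename_tm \<rho> t) = teval M (\<lambda>v. s (\<rho> v)) t"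
proof (induction t)
  case (App f ts)
  then have "map (teval M s \<circ> rename_tm \<rho>) ts = map (teval M (\<lambda>v. s (\<rho> v))) ts"
    by auto
  then show ?case by (simp only: map_map rename_tm.simps teval.simps)
qed simp

lemma eval_rename:
  assumes "inj \<rho>"
  shows "eval M s (rename \<rho> \<phi>) = eval M (\<lambda>v. s (\<rho> v)) \<phi>"
proof (induction \<phi> arbitrary: s)
  case (Dist t u)
  then show ?case by (simp add: teval_rename)
next
  case (Pred p ts)
  have "map (teval M s \<circ> rename_tm \<rho>) ts = map (teval M (\<lambda>v. s (\<rho> v))) ts" by (simp add: teval_rename)
  then show ?case by (simp only: map_map rename.simps eval.simps)
next
  case (Conn c \<phi>s)
  then have "map (eval M s \<circ> rename \<rho>) \<phi>s = map (eval M (\<lambda>v. s (\<rho> v))) \<phi>s" by auto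
  then show ?case by (simp only: map_map rename.simps eval.simps)
next
  case (SupQ v \<phi>)
  have "(\<lambda>w. (s(\<rho> v := m)) (\<rho> w)) = (\<lambda>v. s (\<rho> v))(v := m)" for m
    using assms by (auto simp: fun_eq_iff inj_eq)
  then show ?case by (simp only: rename.simps eval.simps SupQ.IH)
next
  case (InfQ v \<phi>)
  have "(\<lambda>w. (s(\<rho> v := m)) (\<rho> w)) = (\<lambda>v. s (\<rho> v))(v := m)" for m
    using assms by (auto simp: fun_eq_iff inj_eq)
  then show ?case by (simp only: rename.simps eval.simps InfQ.IH)
qed

text \<open>
  A formula that is small exactly when \<open>lo \<le> \<phi> \<le> hi\<close> nearly holds makes approximate satisfaction of
  two-sided bounds accessible to saturation.
\<close>

definition between_fm :: "real \<Rightarrow> real \<Rightarrow> ('f, 'p) fm \<Rightarrow> ('f, 'p) fm" where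
  "between_fm lo hi \<phi> = Conn (\<lambda>v. min 1 (max 0 (max (lo - v 0) (v 0 - hi)))) [\<phi>]"

lemma wf_between_fm: "wf_fm L \<phi> \<Longrightarrow> wf_fm L (between_fm lo hi \<phi>)"
proof -
  have "continuous_on A (\<lambda>v :: nat \<Rightarrow> real. v 0)" for A
    by (intro continuous_on_product_coordinates continuous_on_subset[OF _ subset_UNIV])
  then show "wf_fm L \<phi> \<Longrightarrow> ?thesis"
    by (auto simp: between_fm_def intro!: continuous_intros)
qed

lemma eval_between_fm:
  "eval M s (between_fm lo hi \<phi>) = min 1 (max 0 (max (lo - eval M s \<phi>) (eval M s \<phi> - hi)))"
  by (simp add: between_fm_def vec_of_def)

fun max_fm :: "(nat \<Rightarrow> ('f, 'p) fm) \<Rightarrow> nat \<Rightarrow> ('f, 'p) fm" where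
  "max_fm \<gamma> 0 = \<gamma> 0"
| "max_fm \<gamma> (Suc n) = Conn (\<lambda>v. max (v 0) (v 1)) [max_fm \<gamma> n, \<gamma> (Suc n)]"

lemma wf_max_fm: "(\<And>k. wf_fm L (\<gamma> k)) \<Longrightarrow> wf_fm L (max_fm \<gamma> n)"
proof (induction n)
  case (Suc n)
  have "continuous_on A (\<lambda>v :: nat \<Rightarrow> real. v k)" for A k
    by (intro continuous_on_product_coordinates continuous_on_subset[OF _ subset_UNIV])
  then show ?case using Suc
    by (auto simp: cube_def le_max_iff_disj intro!: continuous_intros)
qed simp

lemma eval_max_fm_le: "eval M s (max_fm \<gamma> n) \<le> e \<longleftrightarrow> (\<forall>k\<le>n. eval M s (\<gamma> k) \<le> e)"
  by (induction n) (auto simp: vec_of_def le_Suc_eq)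

lemma eval_max_fm_less: "eval M s (max_fm \<gamma> n) < e \<longleftrightarrow> (\<forall>k\<le>n. eval M s (\<gamma> k) < e)"
  by (induction n) (auto simp: vec_of_def le_Suc_eq)

definition inf_list :: "nat list \<Rightarrow> ('f, 'p) fm \<Rightarrow> ('f, 'p) fm" where
  "inf_list vs \<phi> = foldr InfQ vs \<phi>"

lemma wf_inf_list: "wf_fm L \<phi> \<Longrightarrow> wf_fm L (inf_list vs \<phi>)"
  by (induction vs) (auto simp: inf_list_def)

lemma eval_inf_list_le:
  assumes M: "is_structure L M" and wf: "wf_fm L \<phi>"
    and "range s \<subseteq> univ M" and "range s' \<subseteq> univ M" and "\<And>v. v \<notin> set vs \<Longrightarrow> s' v = s v"
  shows "eval M s (inf_list vs \<phi>) \<le> eval M s' \<phi>"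
  using assms(3-5)
proof (induction vs arbitrary: s)
  case Nil
  then have "s' = s" by auto
  then show ?case by (simp add: inf_list_def)
next
  case (Cons v vs)
  have in_unit: "eval M (s(v := m)) (inf_list vs \<phi>) \<in> {0..1}" if "m \<in> univ M" for m
    using that Cons.prems by (intro eval_in_unit[OF M wf_inf_list[OF wf]]) auto
  have "eval M s (inf_list (v # vs) \<phi>) = (INF m\<in>univ M. eval M (s(v := m)) (inf_list vs \<phi>))"
    by (simp add: inf_list_def)
  also have "\<dots> \<le> eval M (s(v := s' v)) (inf_list vs \<phi>)"
    using Cons.prems in_unit by (intro cINF_lower bdd_belowI2[where m = 0]) auto
  also have "\<dots> \<le> eval M s' \<phi>"
    using Cons.prems by (intro Cons.IH) (auto simp: fun_upd_def)
  finally show ?case .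
qed

lemma eval_inf_list_less:
  assumes M: "is_structure L M" and wf: "wf_fm L \<phi>"
    and "range s \<subseteq> univ M" and "eval M s (inf_list vs \<phi>) < e"
  shows "\<exists>s'. range s' \<subseteq> univ M \<and> (\<forall>v. v \<notin> set vs \<longrightarrow> s' v = s v) \<and> eval M s' \<phi> < e"
  using assms(3,4)
proof (induction vs arbitrary: s)
  case Nil
  then show ?case by (intro exI[of _ s]) (simp add: inf_list_def)
next
  case (Cons v vs)
  have in_unit: "eval M (s(v := m)) (inf_list vs \<phi>) \<in> {0..1}" if "m \<in> univ M" for m
    using that Cons.prems by (intro eval_in_unit[OF M wf_inf_list[OF wf]]) auto
  have "univ M \<noteq> {}" using M by (simp add: is_structure_def)
  moreover have "(INF m\<in>univ M. eval M (s(v := m)) (inf_list vs \<phi>)) < e"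
    using Cons.prems by (simp add: inf_list_def)
  ultimately obtain m where m: "m \<in> univ M" "eval M (s(v := m)) (inf_list vs \<phi>) < e"
    using in_unit by (subst (asm) cINF_less_iff) (auto intro!: bdd_belowI2[where m = 0])
  have "range (s(v := m)) \<subseteq> univ M" using m Cons.prems by auto
  from Cons.IH[OF this m(2)] obtain s' where s':
    "range s' \<subseteq> univ M" "\<forall>w. w \<notin> set vs \<longrightarrow> s' w = (s(v := m)) w" "eval M s' \<phi> < e" by blast
  show ?case
  proof (intro exI[of _ s'] conjI allI impI)
    fix w assume "w \<notin> set (v # vs)"
    then show "s' w = s w" using s'(2)[rule_format, of w] by simp
  qed (fact s'(1), fact s'(3))
qed

section \<open>Partitioned formulas\<close>

lemma fm_val_map:
  assumes "partitioned_formula L \<phi> x y"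
  shows "fm_val M \<phi> x y (map s x) (map s y) = eval M s \<phi>"
proof -
  have "zip (x @ y) (map s x @ map s y) = zip (x @ y) (map s (x @ y))" by simp
  then show ?thesis unfolding fm_val_def
    using assms by (intro eval_cong) (auto simp: map_of_zip_map partitioned_formula_def subset_iff map_add_def)
qed

lemma tuples_as_assignment:
  assumes "distinct (x @ y)" and "a \<in> tuples (length x) A" and "b \<in> tuples (length y) A"
    and "A \<noteq> {}"
  obtains s where "range s \<subseteq> A" "map s x = a" "map s y = b"
proof -
  obtain u where "u \<in> A" using assms(4) by auto
  define s where "s v = (case map_of (zip (x @ y) (a @ b)) v of Some z \<Rightarrow> z | None \<Rightarrow> u)" for v
  have l: "length (x @ y) = length (a @ b)" using assms by (simp add: tuples_def)
  have "map s (x @ y) = a @ b"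
  proof (rule nth_equalityI)
    fix i assume "i < length (map s (x @ y))"
    then have "map_of (zip (x @ y) (a @ b)) ((x @ y) ! i) = Some ((a @ b) ! i)"
      using map_of_zip_nth[OF l assms(1), of i] l by simp
    then show "map s (x @ y) ! i = (a @ b) ! i"
      using \<open>i < length (map s (x @ y))\<close> by (simp add: s_def flip: map_append)
  qed (use l in simp)
  then have "map s x = a" "map s y = b" using assms by (auto simp: tuples_def)
  moreover have "range s \<subseteq> A"
  proof -
    have "s v \<in> A" for v
    proof (cases "map_of (zip (x @ y) (a @ b)) v")
      case (Some z)
      then have "z \<in> set (a @ b)" by (meson map_of_SomeD set_zip_rightD)
      then show ?thesis using Some assms by (auto simp: s_def tuples_def)
    qed (simp add: s_def \<open>u \<in> A\<close>)
    then show ?thesis by auto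
  qed
  ultimately show thesis using that by blast
qed

lemma fm_val_in_unit:
  assumes M: "is_structure L M" and pf: "partitioned_formula L \<phi> x y"
    and "a \<in> tuples (length x) (univ M)" "b \<in> tuples (length y) (univ M)"
  shows "fm_val M \<phi> x y a b \<in> {0..1}"
proof -
  obtain s where "range s \<subseteq> univ M" "map s x = a" "map s y = b"
    using tuples_as_assignment[of x y a "univ M" b] M pf assms(3,4)
    by (auto simp: partitioned_formula_def is_structure_def)
  then show ?thesis
    using eval_in_unit[OF M, of \<phi> s] fm_val_map[OF pf, of M s] pf
    by (auto simp: partitioned_formula_def)
qed

section \<open>Compactness for countably many variables\<close>

text \<open>
  Saturation speaks of finitely many unknowns; here all variables outside \<open>P\<close> are unknown. They are
  chosen one at a time, keeping the remaining conditions approximately satisfiable; that the value of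
  the next variable does so is expressed by countably many conditions, each an infimum over the
  variables still to be chosen. An infimum expresses approximate satisfaction, whence the form of
  the hypothesis.
\<close>

lemma countable_saturation:
  includes cardinal_syntax
  fixes \<gamma> :: "nat \<Rightarrow> ('f, 'p) fm"
  assumes M: "is_structure L M" and sat: "saturated L \<kappa> M" and \<kappa>: "natLeq <o \<kappa>"
    and wf: "\<And>k. wf_fm L (\<gamma> k)" and s0: "range s0 \<subseteq> univ M"
    and fin: "\<And>n. \<exists>s. range s \<subseteq> univ M \<and> (\<forall>v\<in>P. s v = s0 v) \<and>
                    (\<forall>k\<le>n. eval M s (\<gamma> k) \<le> 1 / (real n + 1))"
  obtains s where "range s \<subseteq> univ M" "\<And>v. v \<in> P \<Longrightarrow> s v = s0 v" "\<And>k. eval M s (\<gamma> k) = 0"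
proof -
  \<comment> \<open>\<open>good n s\<close>: the variables below \<open>n\<close> have been given their values by \<open>s\<close> in a way that can be continued.\<close>
  define good where "good n s \<longleftrightarrow> range s \<subseteq> univ M \<and> (\<forall>v\<in>P. s v = s0 v) \<and>
      (\<forall>m. \<forall>e>0. \<exists>s'. range s' \<subseteq> univ M \<and> (\<forall>v\<in>P \<union> {..<n}. s' v = s v) \<and>
        eval M s' (max_fm \<gamma> m) < e)" for n :: nat and s
  \<comment> \<open>Conditions accumulate with \<open>m\<close>, so precision \<open>2 / (m + 1)\<close> for each \<open>m\<close> yields any precision. The factor
    \<open>2\<close> leaves room for an infimum \<open>\<le> 1 / (m + 1)\<close> that is not attained.\<close>
  have approx: "\<exists>s'. range s' \<subseteq> univ M \<and> (\<forall>v\<in>V. s' v = s v) \<and> eval M s' (max_fm \<gamma> m) < e"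
    if app: "\<And>m. \<exists>s'. range s' \<subseteq> univ M \<and> (\<forall>v\<in>V. s' v = s v) \<and>
              eval M s' (max_fm \<gamma> m) \<le> 2 / (real m + 1)" and "e > 0" for V s m and e :: real
  proof -
    obtain l where l: "2 / e < real l" using reals_Archimedean2 by blast
    define m' where "m' = max m l"
    have "2 < real l * e" using l that(2) by (simp add: pos_divide_less_eq)
    also have "\<dots> \<le> (real m' + 1) * e" using that(2) by (intro mult_right_mono) (auto simp: m'_def)
    finally have "2 / (real m' + 1) < e" by (simp add: pos_divide_less_eq mult.commute)
    moreover obtain s' where s': "range s' \<subseteq> univ M" "\<forall>v\<in>V. s' v = s v"
      "eval M s' (max_fm \<gamma> m') \<le> 2 / (real m' + 1)" using app by blast
    ultimately have "eval M s' (max_fm \<gamma> m') < e" by simp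
    then have "eval M s' (max_fm \<gamma> m) < e" by (auto simp: eval_max_fm_less m'_def)
    then show ?thesis using s' by blast
  qed
  have good0: "good 0 s0"
    unfolding good_def
  proof (intro conjI allI impI)
    fix m and e :: real assume "e > 0"
    have "\<exists>s'. range s' \<subseteq> univ M \<and> (\<forall>v\<in>P \<union> {..<0}. s' v = s0 v) \<and>
            eval M s' (max_fm \<gamma> n) \<le> 2 / (real n + 1)" for n
    proof -
      obtain s where "range s \<subseteq> univ M" "\<forall>v\<in>P. s v = s0 v" "\<forall>k\<le>n. eval M s (\<gamma> k) \<le> 1 / (real n + 1)"
        using fin by blast
      moreover have "1 / (real n + 1) \<le> 2 / (real n + 1)" by (simp add: divide_right_mono)
      ultimately show ?thesis unfolding eval_max_fm_le
        by (intro exI[of _ s]) (auto intro: order_trans)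
    qed
    from approx[OF this \<open>e > 0\<close>]
    show "\<exists>s'. range s' \<subseteq> univ M \<and> (\<forall>v\<in>P \<union> {..<0}. s' v = s0 v) \<and> eval M s' (max_fm \<gamma> m) < e" .
  qed (use s0 in auto)
  have step: "\<exists>t. good (Suc n) t \<and> (\<forall>v. v \<noteq> n \<longrightarrow> t v = s v)" if g: "good n s" for n s
  proof -
    have s: "range s \<subseteq> univ M" "\<forall>v\<in>P. s v = s0 v" using g by (auto simp: good_def)
    \<comment> \<open>The unknown is \<open>n\<close>, or nothing if \<open>n\<close> is a parameter.\<close>
    define X where "X = {n} - P"
    define vs where "vs m = sorted_list_of_set (fv (max_fm \<gamma> m) - (P \<union> {..n}))" for m
    have set_vs: "set (vs m) = fv (max_fm \<gamma> m) - (P \<union> {..n})" for m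
      by (simp add: vs_def finite_fv)
    have wfm: "wf_fm L (max_fm \<gamma> m)" for m by (rule wf_max_fm[OF wf])
    define \<psi> where "\<psi> m = between_fm 0 (1 / (real m + 1)) (inf_list (vs m) (max_fm \<gamma> m))" for m
    define \<Gamma> where "\<Gamma> = range (\<lambda>m. (\<psi> m, s))"
    have \<psi>0: "eval M t (\<psi> m) = 0 \<longleftrightarrow> eval M t (inf_list (vs m) (max_fm \<gamma> m)) \<le> 1 / (real m + 1)"
      if "range t \<subseteq> univ M" for t m
      using eval_in_unit[OF M wf_inf_list[OF wfm] that, of "vs m" m]
      by (auto simp: \<psi>_def eval_between_fm min_def max_def)
    have card: "(card_of (range s), \<kappa>) \<in> ordLess"
      using \<kappa> by (meson card_of_image card_of_nat ordIso_iff_ordLeq ordLeq_ordLess_trans ordLeq_transitive)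
    have part: "satisfied_in M X \<Gamma>0" if sub: "\<Gamma>0 \<subseteq> \<Gamma>" "finite \<Gamma>0" for \<Gamma>0
    proof -
      obtain I where I: "finite I" "\<Gamma>0 = (\<lambda>m. (\<psi> m, s)) ` I"
        using finite_subset_image[of \<Gamma>0 "\<lambda>m. (\<psi> m, s)" UNIV] sub unfolding \<Gamma>_def by blast
      then obtain K where K: "\<forall>m\<in>I. m \<le> K" using finite_nat_set_iff_bounded_le by blast
      have "0 < 1 / (real K + 1)" by simp
      then obtain s' where s': "range s' \<subseteq> univ M" "\<forall>v\<in>P \<union> {..<n}. s' v = s v"
        "eval M s' (max_fm \<gamma> K) < 1 / (real K + 1)" using g unfolding good_def by blast
      define t where "t = override_on s s' X"
      have t: "range t \<subseteq> univ M" using s s'(1) by (auto simp: t_def override_on_def)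
      have "eval M t (\<psi> m) = 0" if "m \<in> I" for m
      proof -
        define t' where "t' = override_on t s' (set (vs m))"
        have "eval M t (inf_list (vs m) (max_fm \<gamma> m)) \<le> eval M t' (max_fm \<gamma> m)"
          using t s'(1) by (intro eval_inf_list_le[OF M wfm]) (auto simp: t'_def override_on_def)
        also have "eval M t' (max_fm \<gamma> m) = eval M s' (max_fm \<gamma> m)"
        proof (rule eval_cong)
          fix v assume v: "v \<in> fv (max_fm \<gamma> m)"
          show "t' v = s' v"
            using v s'(2) by (cases v n rule: linorder_cases)
              (auto simp: t'_def t_def override_on_def set_vs X_def)
        qed
        also have "\<dots> \<le> 1 / (real m + 1)"
        proof -
          have "m \<le> K" using K that by blast
          then have "1 / (real K + 1) \<le> 1 / (real m + 1)" by (simp add: frac_le)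
          then show ?thesis using s'(3) \<open>m \<le> K\<close> unfolding eval_max_fm_less eval_max_fm_le
            by (meson less_imp_le less_le_trans order_trans)
        qed
        finally show ?thesis using \<psi>0[OF t] by simp
      qed
      then show ?thesis unfolding satisfied_in_def
        using s'(1) I(2) by (intro exI[of _ s']) (auto simp: t_def)
    qed
    have wf_\<Gamma>: "\<forall>(\<theta>, e)\<in>\<Gamma>. wf_fm L \<theta> \<and> (\<forall>v\<in>fv \<theta> - X. e v \<in> range s)"
      by (auto simp: \<Gamma>_def \<psi>_def intro!: wf_between_fm wf_inf_list wfm)
    have "finite X" by (simp add: X_def)
    have "\<forall>\<Gamma>0\<subseteq>\<Gamma>. finite \<Gamma>0 \<longrightarrow> satisfied_in M X \<Gamma>0" using part by simp
    then have "satisfied_in M X \<Gamma>"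
      using sat[unfolded saturated_def, THEN spec, THEN spec, THEN spec, THEN mp, THEN mp, THEN mp,
        THEN mp, THEN mp, OF s(1) card \<open>finite X\<close> wf_\<Gamma>] by simp
    then obtain s1 where s1: "s1 ` X \<subseteq> univ M" "\<And>m. eval M (override_on s s1 X) (\<psi> m) = 0"
      unfolding satisfied_in_def \<Gamma>_def by auto
    define t where "t = override_on s s1 X"
    have t: "range t \<subseteq> univ M" using s s1(1) by (auto simp: t_def override_on_def)
    have "good (Suc n) t" unfolding good_def
    proof (intro conjI allI impI)
      show "\<forall>v\<in>P. t v = s0 v" using s(2) by (auto simp: t_def X_def override_on_def)
    next
      fix m and e :: real assume "e > 0"
      have "\<exists>s'. range s' \<subseteq> univ M \<and> (\<forall>v\<in>P \<union> {..<Suc n}. s' v = t v) \<and>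
              eval M s' (max_fm \<gamma> m) \<le> 2 / (real m + 1)" for m
      proof -
        have "eval M t (inf_list (vs m) (max_fm \<gamma> m)) \<le> 1 / (real m + 1)"
          using s1(2) \<psi>0[OF t] by (simp add: t_def)
        also have "\<dots> < 2 / (real m + 1)" by (simp add: divide_strict_right_mono)
        finally obtain s' where "range s' \<subseteq> univ M" "\<forall>v. v \<notin> set (vs m) \<longrightarrow> s' v = t v"
          "eval M s' (max_fm \<gamma> m) < 2 / (real m + 1)"
          using eval_inf_list_less[OF M wfm t] by blast
        then show ?thesis by (intro exI[of _ s']) (auto simp: set_vs)
      qed
      from approx[OF this \<open>e > 0\<close>]
      show "\<exists>s'. range s' \<subseteq> univ M \<and> (\<forall>v\<in>P \<union> {..<Suc n}. s' v = t v) \<and> eval M s' (max_fm \<gamma> m) < e" .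
    qed (rule t)
    then show ?thesis by (intro exI[of _ t]) (auto simp: t_def X_def override_on_def)
  qed
  obtain S where S: "\<And>n. good n (S n)" "\<And>n v. v \<noteq> n \<Longrightarrow> S (Suc n) v = S n v"
    using dependent_nat_choice[of good "\<lambda>n s t. \<forall>v. v \<noteq> n \<longrightarrow> t v = s v"] good0 step by metis
  \<comment> \<open>From stage \<open>Suc v\<close> on the value of \<open>v\<close> is final.\<close>
  define s where "s v = S (Suc v) v" for v
  have stable: "S n v = s v" if "v < n" for n v
    using that
  proof (induction n)
    case (Suc n)
    then show ?case by (cases "v = n") (auto simp: s_def S(2))
  qed simp
  show thesis
  proof (rule that[of s])
    have SM: "range (S n) \<subseteq> univ M" "v \<in> P \<Longrightarrow> S n v = s0 v" for n v
      using S(1)[of n] unfolding good_def by blast+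
    then show "range s \<subseteq> univ M" by (auto simp: s_def)
    show "s v = s0 v" if "v \<in> P" for v using SM(2) that by (simp add: s_def)
    fix k
    obtain n where n: "fv (\<gamma> k) \<subseteq> {..<n}"
      using finite_nat_iff_bounded finite_fv by blast
    have "eval M s (\<gamma> k) \<le> 0 + e" if e: "e > 0" for e
    proof -
      obtain s' where s': "\<forall>v\<in>P \<union> {..<n}. s' v = S n v" "eval M s' (max_fm \<gamma> k) < e"
        using S(1)[of n] e unfolding good_def by blast
      have "eval M s (\<gamma> k) = eval M s' (\<gamma> k)"
        using n s'(1) stable by (intro eval_cong) auto
      then show ?thesis using s'(2) by (auto simp: eval_max_fm_less less_imp_le)
    qed
    then have "eval M s (\<gamma> k) \<le> 0" by (rule field_le_epsilon)
    moreover have "eval M s (\<gamma> k) \<ge> 0"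
      using eval_in_unit[OF M wf \<open>range s \<subseteq> univ M\<close>] by simp
    ultimately show "eval M s (\<gamma> k) = 0" by simp
  qed
qed

text \<open>
  The variables of row \<open>i\<close> carry the tuple \<open>a\<^sub>i\<close> and those of column \<open>j\<close> the tuple \<open>b\<^sub>j\<close>; the renaming
  \<open>cell y i j\<close> moves \<open>\<phi>\<close> to the variables of row \<open>i\<close> and column \<open>j\<close>.
\<close>

definition cell :: "nat list \<Rightarrow> nat \<Rightarrow> nat \<Rightarrow> nat \<Rightarrow> nat" where
  "cell y i j v = (if v \<in> set y then prod_encode (2 * j, v) else prod_encode (2 * i + 1, v))"

definition row :: "nat list \<Rightarrow> (nat \<Rightarrow> 'u) \<Rightarrow> nat \<Rightarrow> 'u list" where
  "row x s i = map (\<lambda>v. s (prod_encode (2 * i + 1, v))) x"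

definition col :: "nat list \<Rightarrow> (nat \<Rightarrow> 'u) \<Rightarrow> nat \<Rightarrow> 'u list" where
  "col y s j = map (\<lambda>v. s (prod_encode (2 * j, v))) y"

lemma inj_cell: "inj (cell y i j)"
  by (auto simp: inj_def cell_def split: if_splits)

lemma eval_rename_cell:
  assumes "partitioned_formula L \<phi> x y"
  shows "eval M s (rename (cell y i j) \<phi>) = fm_val M \<phi> x y (row x s i) (col y s j)"
proof -
  have "row x s i = map (\<lambda>v. s (cell y i j v)) x" "col y s j = map (\<lambda>v. s (cell y i j v)) y"
    using assms by (auto simp: row_def col_def cell_def partitioned_formula_def)
  then show ?thesis by (simp add: eval_rename[OF inj_cell] fm_val_map[OF assms])
qed

lemma rows_cols_as_assignment:
  assumes "distinct (x @ y)" and "A \<noteq> {}"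
    and "\<And>i. a i \<in> tuples (length x) A" and "\<And>j. b j \<in> tuples (length y) A"
  obtains s where "range s \<subseteq> A" "\<And>i. row x s i = a i" "\<And>j. col y s j = b j"
proof -
  have "\<exists>t. range t \<subseteq> A \<and> map t x = a i \<and> map t y = b i" for i
    using tuples_as_assignment[OF assms(1) assms(3) assms(4) assms(2), of i i] by metis
  then obtain t where t: "\<And>i. range (t i) \<subseteq> A" "\<And>i. map (t i) x = a i" "\<And>i. map (t i) y = b i"
    by metis
  define s where "s k = (case prod_decode k of (c, v) \<Rightarrow> t (c div 2) v)" for k
  show thesis
  proof (rule that[of s])
    have "t i v \<in> A" for i v using t(1)[of i] by auto
    then show "range s \<subseteq> A" by (auto simp: s_def split: prod.splits)
  qed (simp_all add: row_def col_def s_def t)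
qed

text \<open>
  Compactness for a matrix of values \<open>\<phi>(a\<^sub>i, b\<^sub>j)\<close>: interval constraints that are approximately
  satisfiable on each finite part are satisfiable. The rows with index in \<open>K\<close> are parameters.
\<close>

lemma realize_matrix:
  includes cardinal_syntax
  fixes lo hi :: "nat \<Rightarrow> nat \<Rightarrow> real" and a0 :: "nat \<Rightarrow> 'u list"
  assumes M: "is_structure L M" and sat: "saturated L \<kappa> M" and \<kappa>: "natLeq <o \<kappa>"
    and pf: "partitioned_formula L \<phi> x y"
    and a0: "\<And>i. a0 i \<in> tuples (length x) (univ M)"
    and fin: "\<And>n. \<exists>a b. (\<forall>i. a i \<in> tuples (length x) (univ M)) \<and>
      (\<forall>j. b j \<in> tuples (length y) (univ M)) \<and> (\<forall>i\<in>K. a i = a0 i) \<and>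
      (\<forall>i\<le>n. \<forall>j\<le>n. lo i j - 1 / (real n + 1) \<le> fm_val M \<phi> x y (a i) (b j) \<and>
                 fm_val M \<phi> x y (a i) (b j) \<le> hi i j + 1 / (real n + 1))"
  obtains a b where "\<And>i. a i \<in> tuples (length x) (univ M)"
    and "\<And>j. b j \<in> tuples (length y) (univ M)" and "\<And>i. i \<in> K \<Longrightarrow> a i = a0 i"
    and "\<And>i j. fm_val M \<phi> x y (a i) (b j) \<in> {lo i j..hi i j}"
proof -
  have xy: "distinct (x @ y)" "wf_fm L \<phi>" using pf by (auto simp: partitioned_formula_def)
  have ne: "univ M \<noteq> {}" using M by (simp add: is_structure_def)
  then obtain u where "u \<in> univ M" by blast
  then have b0: "replicate (length y) u \<in> tuples (length y) (univ M)" by (auto simp: tuples_def)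
  obtain s0 where s0: "range s0 \<subseteq> univ M" "\<And>i. row x s0 i = a0 i"
    using rows_cols_as_assignment[OF xy(1) ne, of a0 "\<lambda>_. replicate (length y) u"] a0 b0 by metis
  define P where "P = {prod_encode (2 * i + 1, v) | i v. i \<in> K \<and> v \<in> set x}"
  have agree: "(\<forall>k\<in>P. s k = s0 k) \<longleftrightarrow> (\<forall>i\<in>K. row x s i = a0 i)" for s
  proof -
    have "row x s i = a0 i \<longleftrightarrow> (\<forall>v\<in>set x. s (prod_encode (2 * i + 1, v)) = s0 (prod_encode (2 * i + 1, v)))"
      for i unfolding s0(2)[symmetric] row_def by (rule map_eq_conv)
    then show ?thesis unfolding P_def by blast
  qed
  define \<gamma> where "\<gamma> m = (case prod_decode m of (i, j) \<Rightarrow>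
      between_fm (lo i j) (hi i j) (rename (cell y i j) \<phi>))" for m
  have wf: "wf_fm L (\<gamma> m)" for m
    using xy by (auto simp: \<gamma>_def intro!: wf_between_fm wf_rename split: prod.splits)
  have "\<exists>s. range s \<subseteq> univ M \<and> (\<forall>v\<in>P. s v = s0 v) \<and> (\<forall>k\<le>n. eval M s (\<gamma> k) \<le> 1 / (real n + 1))" for n
  proof -
    obtain a b where ab: "\<And>i. a i \<in> tuples (length x) (univ M)" "\<And>j. b j \<in> tuples (length y) (univ M)"
      "\<forall>i\<in>K. a i = a0 i"
      "\<forall>i\<le>n. \<forall>j\<le>n. lo i j - 1 / (real n + 1) \<le> fm_val M \<phi> x y (a i) (b j) \<and>
                 fm_val M \<phi> x y (a i) (b j) \<le> hi i j + 1 / (real n + 1)"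
      using fin[of n] by (elim exE conjE) (rule that, simp_all)
    obtain s where s: "range s \<subseteq> univ M" "\<And>i. row x s i = a i" "\<And>j. col y s j = b j"
      using rows_cols_as_assignment[OF xy(1) ne, of a b] ab(1,2) by metis
    have "eval M s (\<gamma> k) \<le> 1 / (real n + 1)" if "k \<le> n" for k
    proof -
      obtain i j where k: "k = prod_encode (i, j)" by (metis prod_decode_inverse surj_pair)
      then have "i \<le> n" "j \<le> n"
        using that le_prod_encode_1[of i j] le_prod_encode_2[of j i] by simp_all
      then have "lo i j - fm_val M \<phi> x y (a i) (b j) \<le> 1 / (real n + 1)"
        "fm_val M \<phi> x y (a i) (b j) - hi i j \<le> 1 / (real n + 1)"
        using ab(4) by (auto simp: algebra_simps)
      then show ?thesis
        by (simp add: k \<gamma>_def eval_between_fm eval_rename_cell[OF pf] s min_le_iff_disj)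
    qed
    then show ?thesis using s(1) agree[of s] ab(3) s(2) by auto
  qed
  from countable_saturation[OF M sat \<kappa> wf s0(1) this] obtain s where
    s: "range s \<subseteq> univ M" "\<And>v. v \<in> P \<Longrightarrow> s v = s0 v" "\<And>k. eval M s (\<gamma> k) = 0" by metis
  show thesis
  proof (rule that[of "row x s" "col y s"])
    show "row x s i \<in> tuples (length x) (univ M)" and "col y s j \<in> tuples (length y) (univ M)" for i j
      using s(1) by (auto simp: row_def col_def tuples_def)
    show "row x s i = a0 i" if "i \<in> K" for i using agree[of s] s(2) that by blast
    show "fm_val M \<phi> x y (row x s i) (col y s j) \<in> {lo i j..hi i j}" for i j
      using s(3)[of "prod_encode (i, j)"]
      by (auto simp: \<gamma>_def eval_between_fm eval_rename_cell[OF pf] min_def max_def split: if_splits)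
  qed
qed

lemma realize_column:
  includes cardinal_syntax
  fixes lo hi :: "nat \<Rightarrow> real" and a :: "nat \<Rightarrow> 'u list"
  assumes M: "is_structure L M" and sat: "saturated L \<kappa> M" and \<kappa>: "natLeq <o \<kappa>"
    and pf: "partitioned_formula L \<phi> x y"
    and a: "\<And>i. a i \<in> tuples (length x) (univ M)"
    and fin: "\<And>n. \<exists>b\<in>tuples (length y) (univ M). \<forall>i\<le>n.
      lo i - 1 / (real n + 1) \<le> fm_val M \<phi> x y (a i) b \<and>
      fm_val M \<phi> x y (a i) b \<le> hi i + 1 / (real n + 1)"
  obtains b where "b \<in> tuples (length y) (univ M)" "\<And>i. fm_val M \<phi> x y (a i) b \<in> {lo i..hi i}"
proof -
  have "\<exists>a' b. (\<forall>i. a' i \<in> tuples (length x) (univ M)) \<and>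
      (\<forall>j. b j \<in> tuples (length y) (univ M)) \<and> (\<forall>i\<in>UNIV. a' i = a i) \<and>
      (\<forall>i\<le>n. \<forall>j\<le>n. lo i - 1 / (real n + 1) \<le> fm_val M \<phi> x y (a' i) (b j) \<and>
                 fm_val M \<phi> x y (a' i) (b j) \<le> hi i + 1 / (real n + 1))" for n :: nat
  proof -
    obtain b where "b \<in> tuples (length y) (univ M)" "\<forall>i\<le>n.
      lo i - 1 / (real n + 1) \<le> fm_val M \<phi> x y (a i) b \<and>
      fm_val M \<phi> x y (a i) b \<le> hi i + 1 / (real n + 1)" using fin by blast
    then show ?thesis using a by (intro exI[of _ a] exI[of _ "\<lambda>_ :: nat. b"]) auto
  qed
  from realize_matrix[OF M sat \<kappa> pf a this] obtain a' b where
    "\<And>j :: nat. b j \<in> tuples (length y) (univ M)" "\<And>i. a' i = a i"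
    "\<And>i (j :: nat). fm_val M \<phi> x y (a' i) (b j) \<in> {lo i..hi i}" by (metis UNIV_I)
  then show thesis by (metis that)
qed

section \<open>Local types\<close>

text \<open>
  The values of a type on a sequence of tuples, although given in an elementary extension, are already
  realized in the saturated structure: the existence of approximate realizations of finitely many
  values is expressed by an infimum, which has the same value in the extension.
\<close>

lemma local_type_realized:
  includes cardinal_syntax
  fixes M :: "('f, 'p, 'u) mstruct" and a :: "nat \<Rightarrow> 'u list"
  assumes M: "is_structure L M" and sat: "saturated L \<kappa> M" and \<kappa>: "natLeq <o \<kappa>"
    and pf: "partitioned_formula L \<phi> x y"
    and A: "A \<subseteq> univ M" and q: "q \<in> local_types L M \<phi> x y A"
    and a: "\<And>i. a i \<in> tuples (length x) A"
  obtains b where "b \<in> tuples (length y) (univ M)" "\<And>i. q (a i) = fm_val M \<phi> x y (a i) b"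
proof -
  obtain N :: "('f, 'p, ('f, 'p, 'u) ext_carrier) mstruct" and h b' where
    N: "is_structure L N" and h: "elementary_map L M N (univ M) h" and b': "b' \<in> tuples (length y) (univ N)"
    and q_eq: "q = (\<lambda>a\<in>tuples (length x) A. fm_val N \<phi> x y (map h a) b')"
    using q unfolding local_types_def mem_Collect_eq by (elim exE conjE) (rule that)
  have qa: "q (a i) = fm_val N \<phi> x y (map h (a i)) b'" for i using a by (simp add: q_eq)
  have aM: "a i \<in> tuples (length x) (univ M)" for i using a A by (force simp: tuples_def)
  have xy: "distinct (x @ y)" "wf_fm L \<phi>" using pf by (auto simp: partitioned_formula_def)
  have ne: "univ M \<noteq> {}" "univ N \<noteq> {}" using M N by (auto simp: is_structure_def)
  then obtain u where u: "u \<in> univ M" by blast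
  have hM: "h ` univ M \<subseteq> univ N" using h by (simp add: elementary_map_def)
  have haN: "map h (a i) \<in> tuples (length x) (univ N)" for i
    using aM[of i] hM by (auto simp: tuples_def)
  have "replicate (length y) u \<in> tuples (length y) (univ M)" using u by (auto simp: tuples_def)
  then obtain s0 where s0: "range s0 \<subseteq> univ M" "\<And>i. row x s0 i = a i"
    using rows_cols_as_assignment[OF xy(1) ne(1), of a "\<lambda>_. replicate (length y) u"] aM by metis
  obtain t where t: "range t \<subseteq> univ N" "\<And>i. row x t i = map h (a i)" "\<And>j :: nat. col y t j = b'"
    using rows_cols_as_assignment[OF xy(1) ne(2), of "\<lambda>i. map h (a i)" "\<lambda>_. b'"] haN b' by metis
  define vs where "vs = map (\<lambda>v. prod_encode (2 * 0, v)) y"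
  define \<gamma> where "\<gamma> i = between_fm (q (a i)) (q (a i)) (rename (cell y i 0) \<phi>)" for i
  have wf: "wf_fm L (max_fm \<gamma> n)" for n
    using xy by (intro wf_max_fm) (auto simp: \<gamma>_def intro!: wf_between_fm wf_rename)
  have "\<exists>b\<in>tuples (length y) (univ M). \<forall>i\<le>n.
      q (a i) - 1 / (real n + 1) \<le> fm_val M \<phi> x y (a i) b \<and>
      fm_val M \<phi> x y (a i) b \<le> q (a i) + 1 / (real n + 1)" for n
  proof -
    define s' where "s' = override_on (h \<circ> s0) t (set vs)"
    have "row x s' i = map h (row x s0 i)" for i
      by (auto simp: s'_def row_def vs_def override_on_def)
    moreover have "col y s' 0 = b'"
      unfolding t(3)[of 0, symmetric] by (auto simp: s'_def col_def vs_def override_on_def)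
    ultimately have "eval N s' (\<gamma> i) = 0" for i
      by (simp add: \<gamma>_def eval_between_fm eval_rename_cell[OF pf] qa s0(2))
    then have "eval N s' (max_fm \<gamma> n) \<le> 0" by (simp add: eval_max_fm_le)
    moreover have "eval N (h \<circ> s0) (inf_list vs (max_fm \<gamma> n)) \<le> eval N s' (max_fm \<gamma> n)"
      using s0(1) hM t(1) by (intro eval_inf_list_le[OF N wf]) (auto simp: s'_def override_on_def)
    moreover have "eval N (h \<circ> s0) (inf_list vs (max_fm \<gamma> n)) = eval M s0 (inf_list vs (max_fm \<gamma> n))"
      using h s0(1) wf_inf_list[OF wf] unfolding elementary_map_def by blast
    ultimately have "eval M s0 (inf_list vs (max_fm \<gamma> n)) < 1 / (real n + 1)"
      by (smt (verit) of_nat_0_le_iff zero_less_divide_1_iff)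
    then obtain s where s: "range s \<subseteq> univ M" "\<forall>v. v \<notin> set vs \<longrightarrow> s v = s0 v"
      "eval M s (max_fm \<gamma> n) < 1 / (real n + 1)"
      using eval_inf_list_less[OF M wf s0(1)] by blast
    have "prod_encode (2 * i + 1, v) \<notin> set vs" for i v by (auto simp: vs_def)
    then have "s (prod_encode (2 * i + 1, v)) = s0 (prod_encode (2 * i + 1, v))" for i v
      using s(2) by blast
    then have row_s: "row x s i = a i" for i
      unfolding s0(2)[symmetric] row_def by simp
    have le: "1 / (real n + 1) \<le> 1" by simp
    show ?thesis
    proof (intro bexI[of _ "col y s 0"] allI impI)
      show "col y s 0 \<in> tuples (length y) (univ M)" using s(1) by (auto simp: col_def tuples_def)
      fix i assume "i \<le> n"
      then have "eval M s (\<gamma> i) < 1 / (real n + 1)" using s(3) by (simp add: eval_max_fm_less)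
      then show "q (a i) - 1 / (real n + 1) \<le> fm_val M \<phi> x y (a i) (col y s 0) \<and>
          fm_val M \<phi> x y (a i) (col y s 0) \<le> q (a i) + 1 / (real n + 1)"
        using le by (auto simp: \<gamma>_def eval_between_fm eval_rename_cell[OF pf] row_s min_less_iff_disj)
    qed
  qed
  from realize_column[OF M sat \<kappa> pf aM this] obtain b where
    "b \<in> tuples (length y) (univ M)" "\<And>i. fm_val M \<phi> x y (a i) b \<in> {q (a i)..q (a i)}"
    by metis
  then show thesis by (intro that[of b]) (auto simp: order_antisym)
qed

lemma local_type_in_unit:
  fixes M :: "('f, 'p, 'u) mstruct"
  assumes pf: "partitioned_formula L \<phi> x y" and A: "A \<subseteq> univ M"
    and q: "q \<in> local_types L M \<phi> x y A" and a: "a \<in> tuples (length x) A"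
  shows "q a \<in> {0..1}"
proof -
  obtain N :: "('f, 'p, ('f, 'p, 'u) ext_carrier) mstruct" and h b' where
    N: "is_structure L N" and h: "elementary_map L M N (univ M) h" and b': "b' \<in> tuples (length y) (univ N)"
    and q_eq: "q = (\<lambda>a\<in>tuples (length x) A. fm_val N \<phi> x y (map h a) b')"
    using q unfolding local_types_def mem_Collect_eq by (elim exE conjE) (rule that)
  have "map h a \<in> tuples (length x) (univ N)"
    using a A h by (auto simp: elementary_map_def tuples_def)
  from fm_val_in_unit[OF N pf this b'] show ?thesis using a by (simp add: q_eq)
qed

lemma topspace_type_space: "topspace (type_space L M \<phi> x y A) = local_types L M \<phi> x y A"
  by (auto simp: type_space_def local_types_def)

lemma openin_type_space:
  assumes "a \<in> tuples (length x) A"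
  shows "openin (type_space L M \<phi> x y A) {q \<in> local_types L M \<phi> x y A. q a > t}"
    and "openin (type_space L M \<phi> x y A) {q \<in> local_types L M \<phi> x y A. q a < t}"
proof -
  have "continuous_map (type_space L M \<phi> x y A) euclideanreal (\<lambda>q. q a)"
    unfolding type_space_def
    by (intro continuous_map_from_subtopology continuous_map_product_projection assms)
  from openin_continuous_map_preimage[OF this, of "{t<..}"]
    openin_continuous_map_preimage[OF this, of "{..<t}"]
  show "openin (type_space L M \<phi> x y A) {q \<in> local_types L M \<phi> x y A. q a > t}"
    and "openin (type_space L M \<phi> x y A) {q \<in> local_types L M \<phi> x y A. q a < t}"
    by (simp_all add: topspace_type_space)
qed

text \<open>
  Elementary extensions live on the type of sequences, so that the structure itself has to be
  copied along an embedding of its carrier before its elements can realize types.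
\<close>

definition copy_along :: "('u \<Rightarrow> 'v) \<Rightarrow> ('f, 'p, 'u) mstruct \<Rightarrow> ('f, 'p, 'v) mstruct" where
  "copy_along h M = \<lparr>univ = h ` univ M, mdist = \<lambda>x y. mdist M (inv h x) (inv h y),
     fint = \<lambda>f l. h (fint M f (map (inv h) l)), pint = \<lambda>p l. pint M p (map (inv h) l)\<rparr>"

lemma copy_along_simps:
  "univ (copy_along h M) = h ` univ M"
  "mdist (copy_along h M) u v = mdist M (inv h u) (inv h v)"
  "fint (copy_along h M) f l = h (fint M f (map (inv h) l))"
  "pint (copy_along h M) p l = pint M p (map (inv h) l)"
  by (simp_all add: copy_along_def)

lemma teval_copy: "inj h \<Longrightarrow> teval (copy_along h M) (\<lambda>v. h (s v)) t = h (teval M s t)"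
proof (induction t)
  case (App f ts)
  then have "map (inv h) (map (teval (copy_along h M) (\<lambda>v. h (s v))) ts) = map (teval M s) ts" by auto
  then show ?case by (simp only: teval.simps copy_along_simps)
qed simp

lemma eval_copy: "inj h \<Longrightarrow> eval (copy_along h M) (\<lambda>v. h (s v)) \<phi> = eval M s \<phi>"
proof (induction \<phi> arbitrary: s)
  case (Dist t u)
  then show ?case by (simp add: teval_copy copy_along_simps)
next
  case (Pred p ts)
  then have "map (inv h) (map (teval (copy_along h M) (\<lambda>v. h (s v))) ts) = map (teval M s) ts"
    by (simp add: teval_copy)
  then show ?case by (simp only: eval.simps copy_along_simps)
next
  case (Conn c \<phi>s)
  then have "map (eval (copy_along h M) (\<lambda>v. h (s v))) \<phi>s = map (eval M s) \<phi>s" by auto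
  then show ?case by (simp only: eval.simps)
next
  case (SupQ v \<phi>)
  have "(\<lambda>w. h (s w))(v := h m) = (\<lambda>w. h ((s(v := m)) w))" for m by auto
  moreover have "univ (copy_along h M) = h ` univ M" by (simp add: copy_along_def)
  ultimately show ?case using SupQ by (simp only: eval.simps image_image)
next
  case (InfQ v \<phi>)
  have "(\<lambda>w. h (s w))(v := h m) = (\<lambda>w. h ((s(v := m)) w))" for m by auto
  moreover have "univ (copy_along h M) = h ` univ M" by (simp add: copy_along_def)
  ultimately show ?case using InfQ by (simp only: eval.simps image_image)
qed

lemma Metric_space_copy:
  assumes h: "inj h" and "Metric_space A d"
  shows "Metric_space (h ` A) (\<lambda>x y. d (inv h x) (inv h y))"
proof -
  interpret Metric_space A d by fact
  show ?thesis by unfold_locales (auto simp: h commute triangle)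
qed

lemma mcomplete_copy:
  assumes h: "inj h" and ms: "Metric_space A d" and c: "Metric_space.mcomplete A d"
  shows "Metric_space.mcomplete (h ` A) (\<lambda>x y. d (inv h x) (inv h y))"
proof -
  interpret A: Metric_space A d by fact
  interpret B: Metric_space "h ` A" "\<lambda>x y. d (inv h x) (inv h y)" by (rule Metric_space_copy[OF h ms])
  show ?thesis unfolding B.mcomplete_def
  proof (intro allI impI)
    fix \<sigma> assume \<sigma>: "B.MCauchy \<sigma>"
    have \<sigma>A: "\<sigma> n \<in> h ` A" for n using \<sigma> unfolding B.MCauchy_def by blast
    have inv: "inv h (\<sigma> n) \<in> A" for n
    proof -
      obtain u where "u \<in> A" "\<sigma> n = h u" using \<sigma>A[of n] by blast
      then show ?thesis by (simp add: h)
    qed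
    then have "A.MCauchy (inv h \<circ> \<sigma>)"
      using \<sigma> unfolding A.MCauchy_def B.MCauchy_def by (simp add: image_subset_iff)
    then obtain l where "limitin A.mtopology (inv h \<circ> \<sigma>) l sequentially"
      using c unfolding A.mcomplete_def by blast
    then have "limitin B.mtopology \<sigma> (h l) sequentially"
      unfolding A.limit_metric_sequentially B.limit_metric_sequentially by (simp add: h \<sigma>A inv)
    then show "\<exists>x. limitin B.mtopology \<sigma> x sequentially" by blast
  qed
qed

lemma map_inv_in_tuples: "inj h \<Longrightarrow> a \<in> tuples n (h ` A) \<Longrightarrow> map (inv h) a \<in> tuples n A"
  by (force simp: tuples_def)

lemma is_structure_copy:
  assumes h: "inj h" and M: "is_structure L M"
  shows "is_structure L (copy_along h M)"
proof -
  have close: "close_tuples (copy_along h M) e a b = close_tuples M e (map (inv h) a) (map (inv h) b)"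
    for e a b by (simp add: close_tuples_def copy_along_def list_all2_map1 list_all2_map2)
  have "Metric_space (univ (copy_along h M)) (mdist (copy_along h M))"
    "Metric_space.mcomplete (univ (copy_along h M)) (mdist (copy_along h M))"
    using M Metric_space_copy[OF h] mcomplete_copy[OF h] by (simp_all add: is_structure_def copy_along_def)
  moreover have "univ (copy_along h M) \<noteq> {}"
    "\<forall>x\<in>univ (copy_along h M). \<forall>y\<in>univ (copy_along h M). mdist (copy_along h M) x y \<le> 1"
    using M h by (auto simp: is_structure_def copy_along_def)
  moreover note inv = map_inv_in_tuples[OF h, of _ _ "univ M"]
  have "\<forall>f\<in>fsyms L. \<forall>a\<in>tuples (farity L f) (univ (copy_along h M)).
      fint (copy_along h M) f a \<in> univ (copy_along h M)"
    using M inv by (auto simp: is_structure_def copy_along_def)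
  moreover have "\<forall>p\<in>psyms L. \<forall>a\<in>tuples (parity L p) (univ (copy_along h M)).
      pint (copy_along h M) p a \<in> {0..1}"
    using M inv by (auto simp: is_structure_def copy_along_def)
  moreover have "mdist (copy_along h M) (fint (copy_along h M) f a) (fint (copy_along h M) f b) \<le> e"
    if "f \<in> fsyms L" "e \<in> {0<..1}" "a \<in> tuples (farity L f) (univ (copy_along h M))"
      "b \<in> tuples (farity L f) (univ (copy_along h M))"
      "close_tuples (copy_along h M) (fmod L f e) a b" for f e a b
  proof -
    have "map (inv h) a \<in> tuples (farity L f) (univ M)" "map (inv h) b \<in> tuples (farity L f) (univ M)"
      using inv that(3,4) by (auto simp: copy_along_def)
    then have "mdist M (fint M f (map (inv h) a)) (fint M f (map (inv h) b)) \<le> e"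
      using M that(1,2,5) unfolding is_structure_def close by blast
    then show ?thesis using h by (simp add: copy_along_def)
  qed
  moreover have "\<bar>pint (copy_along h M) p a - pint (copy_along h M) p b\<bar> \<le> e"
    if "p \<in> psyms L" "e \<in> {0<..1}" "a \<in> tuples (parity L p) (univ (copy_along h M))"
      "b \<in> tuples (parity L p) (univ (copy_along h M))"
      "close_tuples (copy_along h M) (pmod L p e) a b" for p e a b
  proof -
    have "map (inv h) a \<in> tuples (parity L p) (univ M)" "map (inv h) b \<in> tuples (parity L p) (univ M)"
      using inv that(3,4) by (auto simp: copy_along_def)
    then have "\<bar>pint M p (map (inv h) a) - pint M p (map (inv h) b)\<bar> \<le> e"
      using M that(1,2,5) unfolding is_structure_def close by blast
    then show ?thesis by (simp add: copy_along_def)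
  qed
  ultimately show ?thesis unfolding is_structure_def by blast
qed

lemma realized_local_type:
  fixes M :: "('f, 'p, 'u) mstruct"
  assumes M: "is_structure L M" and pf: "partitioned_formula L \<phi> x y"
    and A: "A \<subseteq> univ M" and b: "b \<in> tuples (length y) (univ M)"
  shows "(\<lambda>a\<in>tuples (length x) A. fm_val M \<phi> x y a b) \<in> local_types L M \<phi> x y A"
proof -
  define h :: "'u \<Rightarrow> ('f, 'p, 'u) ext_carrier" where "h u = (\<lambda>_. Inl u)" for u
  have h: "inj h" by (auto simp: inj_def h_def fun_eq_iff)
  have el: "elementary_map L M (copy_along h M) (univ M) h"
    using eval_copy[OF h, of M] by (auto simp: elementary_map_def comp_def) (simp add: copy_along_def)
  have hb: "map h b \<in> tuples (length y) (univ (copy_along h M))"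
    using b by (auto simp: tuples_def copy_along_def)
  have "fm_val (copy_along h M) \<phi> x y (map h a) (map h b) = fm_val M \<phi> x y a b"
    if "a \<in> tuples (length x) A" for a
  proof -
    have "a \<in> tuples (length x) (univ M)" using that A by (auto simp: tuples_def)
    then obtain s where s: "range s \<subseteq> univ M" "map s x = a" "map s y = b"
      using tuples_as_assignment[of x y a "univ M" b] M pf b
      by (auto simp: partitioned_formula_def is_structure_def)
    then have "map h a = map (\<lambda>v. h (s v)) x" "map h b = map (\<lambda>v. h (s v)) y" by auto
    then show ?thesis
      using fm_val_map[OF pf, of M s] fm_val_map[OF pf, of _ "\<lambda>v. h (s v)"] s eval_copy[OF h] by metis
  qed
  then have "(\<lambda>a\<in>tuples (length x) A. fm_val M \<phi> x y a b) =
      (\<lambda>a\<in>tuples (length x) A. fm_val (copy_along h M) \<phi> x y (map h a) (map h b))"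
    by (intro restrict_ext) simp
  then show ?thesis using is_structure_copy[OF h M] el hb unfolding local_types_def by blast
qed

section \<open>Alternation of a sequence between two levels\<close>

text \<open>
  Two versions are used: \<open>pattern\<close> has closed conditions on the first \<open>N\<close> terms, as compactness and the
  independence property require, while \<open>alternates\<close> has open conditions on \<open>m\<close> terms beyond \<open>n\<close>, which
  define open sets of types. Both start high, so the last of \<open>m\<close> terms is high exactly if \<open>m\<close> is odd.
\<close>

definition pattern :: "real \<Rightarrow> real \<Rightarrow> nat \<Rightarrow> (nat \<Rightarrow> real) \<Rightarrow> bool" where
  "pattern r s N f \<longleftrightarrow> (\<forall>k<N. if even k then s \<le> f k else f k \<le> r)"

definition alternates :: "nat \<Rightarrow> real \<Rightarrow> real \<Rightarrow> nat \<Rightarrow> (nat \<Rightarrow> real) \<Rightarrow> bool" where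
  "alternates n r s m f \<longleftrightarrow>
     (\<exists>i :: nat \<Rightarrow> nat. strict_mono i \<and> n \<le> i 0 \<and> (\<forall>k<m. if even k then s < f (i k) else f (i k) < r))"

text \<open>
  Uniformity of \<open>N\<close> over \<open>B\<close> is what pointwise convergence lacks. An initial segment is disregarded so that
  a diagonal sequence, which is only eventually a subsequence of each given one, can have the property.
\<close>

definition bounded_alternation :: "'b set \<Rightarrow> (nat \<Rightarrow> 'b \<Rightarrow> real) \<Rightarrow> bool" where
  "bounded_alternation B F \<longleftrightarrow>
     (\<forall>r s. r < s \<longrightarrow> (\<exists>N n. \<forall>b\<in>B. \<not> alternates n r s N (\<lambda>i. F i b)))"

lemma bounded_alternationD:
  assumes "bounded_alternation B F" "r < s"
  obtains N n where "\<And>b. b \<in> B \<Longrightarrow> \<not> alternates n r s N (\<lambda>i. F i b)"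
  using assms unfolding bounded_alternation_def by blast

lemma alternates_mono:
  assumes "alternates n r s m f" and "n' \<le> n" "r \<le> r'" "s' \<le> s" "m' \<le> m"
  shows "alternates n' r' s' m' f"
proof -
  obtain i where i: "strict_mono i" "n \<le> i 0"
    "\<And>k. k < m \<Longrightarrow> if even k then s < f (i k) else f (i k) < r"
    using assms(1) unfolding alternates_def by blast
  have "if even k then s' < f (i k) else f (i k) < r'" if "k < m'" for k
    using i(3)[of k] that assms(3-5) by (auto split: if_splits)
  then show ?thesis using i(1,2) assms(2) unfolding alternates_def by (meson order_trans)
qed

lemma alternates_subseq:
  assumes "alternates n r s m (\<lambda>i. f (g i))" and g: "strict_mono g"
  shows "alternates (g n) r s m f"
proof -
  obtain i where i: "strict_mono i" "n \<le> i 0"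
    "\<And>k. k < m \<Longrightarrow> if even k then s < f (g (i k)) else f (g (i k)) < r"
    using assms(1) unfolding alternates_def by blast
  have "strict_mono (\<lambda>k. g (i k))" using i(1) g by (simp add: strict_mono_def)
  moreover have "g n \<le> g (i 0)" using i(2) g by (simp add: strict_mono_less_eq)
  ultimately show ?thesis using i(3) unfolding alternates_def by (intro exI[of _ "\<lambda>k. g (i k)"]) simp
qed

lemma alternates_shift:
  assumes "alternates (n + d) r s m f"
  shows "alternates n r s m (\<lambda>i. f (d + i))"
proof -
  obtain i where i: "strict_mono i" "n + d \<le> i 0"
    "\<And>k. k < m \<Longrightarrow> if even k then s < f (i k) else f (i k) < r"
    using assms unfolding alternates_def by blast
  have le: "n + d \<le> i k" for k
    using i(2) strict_mono_less_eq[OF i(1), of 0 k] by simp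
  have eq: "d + (i k - d) = i k" for k using le[of k] by simp
  have "strict_mono (\<lambda>k. i k - d)"
    unfolding strict_mono_def using i(1) le by (metis add_leD2 diff_less_mono strict_monoD)
  moreover have "n \<le> i 0 - d" using i(2) by simp
  moreover have "\<forall>k<m. if even k then s < f (d + (i k - d)) else f (d + (i k - d)) < r"
    unfolding eq using i(3) by blast
  ultimately show ?thesis unfolding alternates_def by blast
qed

lemma alternates_imp_pattern:
  assumes "alternates n r s m f"
  obtains i where "strict_mono i" "pattern r s m (\<lambda>k. f (i k))"
proof -
  obtain i where i: "strict_mono i" "\<And>k. k < m \<Longrightarrow> if even k then s < f (i k) else f (i k) < r"
    using assms unfolding alternates_def by blast
  have "pattern r s m (\<lambda>k. f (i k))"
    unfolding pattern_def using i(2) by (metis less_imp_le)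
  then show thesis using i(1) that by blast
qed

lemma strict_mono_on_extend:
  fixes r :: "nat \<Rightarrow> nat"
  assumes "strict_mono_on {..<m} r"
  obtains i where "strict_mono i" "\<And>k. k < m \<Longrightarrow> i k = r k"
proof -
  define i where "i k = (if k < m then r k else k + (\<Sum>l<m. r l))" for k
  have "r k < Suc (\<Sum>l<m. r l)" if "k < m" for k
    using member_le_sum[of k "{..<m}" r] that by simp
  then have "i k < i (Suc k)" for k
    using strict_mono_onD[OF assms, of k "Suc k"]
    by (cases "Suc k < m"; cases "k < m") (fastforce simp: i_def)+
  then have "strict_mono i" by (simp add: strict_mono_Suc_iff)
  then show thesis by (rule that) (simp add: i_def)
qed

text \<open>
  An alternation that ends high can be continued as soon as a later term is low, and conversely;
  the next step has to be high exactly if the number \<open>m\<close> of steps made is even.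
\<close>

lemma alternates_Suc:
  assumes "alternates n r s m f"
    and later: "\<And>l. \<exists>j\<ge>l. if even m then s < f j else f j < r"
  shows "alternates n r s (Suc m) f"
proof -
  obtain i where i: "strict_mono i" "n \<le> i 0" "\<And>k. k < m \<Longrightarrow> if even k then s < f (i k) else f (i k) < r"
    using assms(1) unfolding alternates_def by blast
  obtain j where j: "i m \<le> j" "if even m then s < f j else f j < r" using later by blast
  have "i k < j" if "k < m" for k using strict_monoD[OF i(1) that] j(1) by simp
  then have "strict_mono_on {..<Suc m} (\<lambda>k. if k < m then i k else j)"
    using strict_monoD[OF i(1)] by (auto intro!: strict_mono_onI)
  then obtain i' where i': "strict_mono i'" "\<And>k. k < Suc m \<Longrightarrow> i' k = (if k < m then i k else j)"
    using strict_mono_on_extend by blast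
  have "n \<le> i' 0" using i(2) j(1) i'(2)[of 0] by (cases m) auto
  moreover have "if even k then s < f (i' k) else f (i' k) < r" if "k < Suc m" for k
    using i'(2)[OF that] i(3)[of k] j(2) that by (cases "k = m") (auto simp: less_Suc_eq)
  ultimately show ?thesis using i'(1) unfolding alternates_def by blast
qed

lemma alternates_0: "alternates n r s 0 f"
  unfolding alternates_def by (intro exI[of _ "\<lambda>k. n + k"]) (simp add: strict_mono_def)

lemma alternates_if_frequently:
  assumes "\<And>l. \<exists>j\<ge>l. s < f j" and "\<And>l. \<exists>j\<ge>l. f j < r"
  shows "alternates n r s m f"
proof (induction m)
  case (Suc m)
  show ?case by (rule alternates_Suc[OF Suc]) (use assms in \<open>cases "even m"; auto\<close>)
qed (rule alternates_0)

text \<open>A bounded divergent sequence crosses back and forth between two levels infinitely often.\<close>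

lemma convergent_if_not_alternating:
  fixes f :: "nat \<Rightarrow> real"
  assumes bounded: "\<And>i. f i \<in> {0..1}"
    and alt: "\<And>r s. r < s \<Longrightarrow> \<exists>N n. \<not> alternates n r s N f"
  shows "convergent f"
proof -
  have "\<bar>f i\<bar> \<le> 1" for i using bounded[of i] by auto
  then have "bounded (range f)" by (intro boundedI[where B = 1]) auto
  then obtain l \<rho> where \<rho>: "strict_mono \<rho>" "(f \<circ> \<rho>) \<longlonglongrightarrow> l"
    using bounded_imp_convergent_subsequence by blast
  have near: "\<exists>j\<ge>k. \<bar>f j - l\<bar> < e" if e: "e > 0" for k e
  proof -
    obtain K where K: "\<forall>n\<ge>K. \<bar>(f \<circ> \<rho>) n - l\<bar> < e" using LIMSEQ_D[OF \<rho>(2) e] by auto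
    then have "\<bar>f (\<rho> (max K k)) - l\<bar> < e" by simp
    moreover have "k \<le> \<rho> (max K k)" using seq_suble[OF \<rho>(1), of "max K k"] by simp
    ultimately show ?thesis by blast
  qed
  have "f \<longlonglongrightarrow> l"
  proof (rule ccontr)
    assume "\<not> f \<longlonglongrightarrow> l"
    then obtain e where e: "e > 0" "\<And>k. \<exists>j\<ge>k. \<bar>f j - l\<bar> \<ge> e"
      unfolding LIMSEQ_def dist_real_def by (meson not_less)
    show False
    proof (cases "\<forall>k. \<exists>j\<ge>k. f j \<ge> l + e")
      case True
      have "alternates n (l + e / 3) (l + e / 2) N f" for n N
      proof (rule alternates_if_frequently)
        fix k
        show "\<exists>j\<ge>k. l + e / 2 < f j" using True e(1) by (smt (verit) field_sum_of_halves)
        obtain j where "j \<ge> k" "\<bar>f j - l\<bar> < e / 3" using near[of "e / 3" k] e(1) by auto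
        then show "\<exists>j\<ge>k. f j < l + e / 3" by (intro exI[of _ j] conjI; linarith)
      qed
      then show False using alt[of "l + e / 3" "l + e / 2"] e(1) by auto
    next
      case False
      then obtain k0 where k0: "\<And>j. j \<ge> k0 \<Longrightarrow> f j < l + e" by (meson not_less)
      have "alternates n (l - e / 2) (l - e / 3) N f" for n N
      proof (rule alternates_if_frequently)
        fix k
        obtain j where j: "j \<ge> max k k0" "\<bar>f j - l\<bar> \<ge> e" using e(2) by blast
        then have "f j < l - e / 2" using k0[of j] e(1) by (auto simp: abs_if split: if_splits)
        then show "\<exists>j\<ge>k. f j < l - e / 2" using j(1) by (intro exI[of _ j]) auto
        obtain j where "j \<ge> k" "\<bar>f j - l\<bar> < e / 3" using near[of "e / 3" k] e(1) by auto
        then show "\<exists>j\<ge>k. l - e / 3 < f j" by (intro exI[of _ j] conjI; linarith)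
      qed
      then show False using alt[of "l - e / 2" "l - e / 3"] e(1) by auto
    qed
  qed
  then show ?thesis by (rule convergentI)
qed

section \<open>Subsequences with bounded alternation\<close>

lemma sorted_list_of_strict_mono_image:
  fixes i :: "nat \<Rightarrow> nat"
  assumes "strict_mono i"
  shows "sorted_list_of_set (i ` {..<N}) = map i [0..<N]"
proof -
  have "sorted (map i [0..<N])" "distinct (map i [0..<N])"
    using assms by (auto simp: sorted_iff_nth_mono strict_mono_less_eq distinct_map strict_mono_imp_inj_on)
  then have "sorted_list_of_set (set (map i [0..<N])) = map i [0..<N]"
    by (rule sorted_list_of_set.idem_if_sorted_distinct)
  then show ?thesis by (simp add: atLeast0LessThan)
qed

text \<open>
  Ramsey's theorem makes the occurrence of the alternating pattern independent of the indices; it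
  cannot occur everywhere.
\<close>

lemma subseq_not_alternating:
  fixes G :: "nat \<Rightarrow> 'b \<Rightarrow> real"
  assumes blocked: "\<And>j :: nat \<Rightarrow> nat. strict_mono j \<Longrightarrow>
      \<exists>i. strict_mono i \<and> (\<forall>b\<in>B. \<not> pattern r s N (\<lambda>k. G (j (i k)) b))"
  obtains j where "strict_mono j" "\<And>b. b \<in> B \<Longrightarrow> \<not> alternates 0 r s N (\<lambda>i. G (j i) b)"
proof -
  \<comment> \<open>The colour of an \<open>N\<close>-element set of indices tells whether the pattern occurs along it.\<close>
  define hits where "hits X = (if \<exists>b\<in>B. pattern r s N (\<lambda>k. G (sorted_list_of_set X ! k) b)
    then 1 else 0 :: nat)" for X
  have hits_image: "hits (i ` {..<N}) = 1 \<longleftrightarrow> (\<exists>b\<in>B. pattern r s N (\<lambda>k. G (i k) b))"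
    if "strict_mono i" for i
  proof -
    have "pattern r s N (\<lambda>k. G (map i [0..<N] ! k) b) = pattern r s N (\<lambda>k. G (i k) b)" for b
      by (simp add: pattern_def cong: imp_cong)
    then show ?thesis
      unfolding hits_def sorted_list_of_strict_mono_image[OF that] by simp
  qed
  have "hits X < 2" for X by (simp add: hits_def)
  then obtain Y t where Y: "infinite Y" "\<And>X. X \<subseteq> Y \<Longrightarrow> finite X \<Longrightarrow> card X = N \<Longrightarrow> hits X = t"
    using Ramsey[of "UNIV :: nat set" N hits 2] infinite_UNIV_nat by metis
  obtain j :: "nat \<Rightarrow> nat" where j: "strict_mono j" "\<And>n. j n \<in> Y" using infinite_enumerate[OF Y(1)] by blast
  have t: "hits ((\<lambda>k. j (i k)) ` {..<N}) = t" and mono: "strict_mono (\<lambda>k. j (i k))" if i: "strict_mono i" for i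
  proof -
    show m: "strict_mono (\<lambda>k. j (i k))" using j(1) i by (simp add: strict_mono_def)
    show "hits ((\<lambda>k. j (i k)) ` {..<N}) = t"
      using j(2) card_image[OF strict_mono_imp_inj_on[OF m], of "{..<N}"]
      by (intro Y(2)) (auto simp: image_subset_iff)
  qed
  obtain i where i: "strict_mono i" "\<And>b. b \<in> B \<Longrightarrow> \<not> pattern r s N (\<lambda>k. G (j (i k)) b)"
    using blocked[OF j(1)] by blast
  then have "t \<noteq> 1" using t[OF i(1)] hits_image[OF mono[OF i(1)]] by auto
  show thesis
  proof (rule that[OF j(1)])
    fix b assume b: "b \<in> B"
    show "\<not> alternates 0 r s N (\<lambda>i. G (j i) b)"
    proof
      assume "alternates 0 r s N (\<lambda>i. G (j i) b)"
      then obtain i where "strict_mono i" "pattern r s N (\<lambda>k. G (j (i k)) b)"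
        by (rule alternates_imp_pattern)
      then show False using hits_image[OF mono] t \<open>t \<noteq> 1\<close> b by metis
    qed
  qed
qed

text \<open>A diagonal sequence serves all pairs of rational levels at once.\<close>

lemma subseq_bounded_alternation:
  fixes F :: "nat \<Rightarrow> 'b \<Rightarrow> real"
  assumes blocked: "\<And>r s. r < s \<Longrightarrow> \<exists>N. \<forall>j :: nat \<Rightarrow> nat. strict_mono j \<longrightarrow>
      (\<exists>i. strict_mono i \<and> (\<forall>b\<in>B. \<not> pattern r s N (\<lambda>k. F (j (i k)) b)))"
  obtains j where "strict_mono j" "bounded_alternation B (\<lambda>i. F (j i))"
proof -
  \<comment> \<open>An enumeration of the pairs of rational levels.\<close>
  define R S :: "nat \<Rightarrow> real" where "R n = of_rat (fst (from_nat n :: rat \<times> rat))"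
    and "S n = of_rat (snd (from_nat n :: rat \<times> rat))" for n
  define P where "P n j \<longleftrightarrow> (R n < S n \<longrightarrow>
      (\<exists>N m. \<forall>b\<in>B. \<not> alternates m (R n) (S n) N (\<lambda>i. F (j i) b)))" for n and j :: "nat \<Rightarrow> nat"
  interpret subseqs P
  proof
    fix n and s :: "nat \<Rightarrow> nat" assume s: "strict_mono s"
    show "\<exists>r'. strict_mono r' \<and> P n (s \<circ> r')"
    proof (cases "R n < S n")
      case True
      then obtain N where N: "\<And>j :: nat \<Rightarrow> nat. strict_mono j \<Longrightarrow>
          \<exists>i. strict_mono i \<and> (\<forall>b\<in>B. \<not> pattern (R n) (S n) N (\<lambda>k. F (j (i k)) b))"
        using blocked by blast
      have "\<exists>i. strict_mono i \<and> (\<forall>b\<in>B. \<not> pattern (R n) (S n) N (\<lambda>k. F (s (j (i k))) b))"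
        if "strict_mono j" for j :: "nat \<Rightarrow> nat"
        using N[of "s \<circ> j"] s that by (simp add: strict_mono_o)
      from subseq_not_alternating[of B "R n" "S n" N "\<lambda>i. F (s i)", OF this] obtain j where
        "strict_mono j" "\<And>b. b \<in> B \<Longrightarrow> \<not> alternates 0 (R n) (S n) N (\<lambda>i. F (s (j i)) b)"
        by blast
      then show ?thesis unfolding P_def by (intro exI[of _ j]) auto
    next
      case False
      then show ?thesis by (auto simp: P_def intro: strict_mono_id)
    qed
  qed
  define D where "D = diagseq"
  have P_diag: "P n D" for n
  proof -
    have tail: "P n (D \<circ> (+) (Suc n))"
      unfolding D_def
    proof (rule diagseq_holds)
      fix r s :: "nat \<Rightarrow> nat" and n assume r: "strict_mono r" and "P n s"
      show "P n (s \<circ> r)" unfolding P_def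
      proof
        assume "R n < S n"
        then obtain N m where Nm: "\<And>b. b \<in> B \<Longrightarrow> \<not> alternates m (R n) (S n) N (\<lambda>i. F (s i) b)"
          using \<open>P n s\<close> unfolding P_def by blast
        have "\<not> alternates m (R n) (S n) N (\<lambda>i. F ((s \<circ> r) i) b)" if "b \<in> B" for b
        proof
          assume "alternates m (R n) (S n) N (\<lambda>i. F ((s \<circ> r) i) b)"
          then have "alternates (r m) (R n) (S n) N (\<lambda>i. F (s i) b)"
            using alternates_subseq[OF _ r, of m _ _ N "\<lambda>i. F (s i) b"] by simp
          then have "alternates m (R n) (S n) N (\<lambda>i. F (s i) b)"
            by (rule alternates_mono) (auto intro: seq_suble[OF r])
          then show False using Nm that by blast
        qed
        then show "\<exists>N m. \<forall>b\<in>B. \<not> alternates m (R n) (S n) N (\<lambda>i. F ((s \<circ> r) i) b)" by blast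
      qed
    qed
    show ?thesis unfolding P_def
    proof
      assume "R n < S n"
      then obtain N m where
        "\<And>b. b \<in> B \<Longrightarrow> \<not> alternates m (R n) (S n) N (\<lambda>i. F (D (Suc n + i)) b)"
        using tail unfolding P_def by auto
      then have "\<forall>b\<in>B. \<not> alternates (m + Suc n) (R n) (S n) N (\<lambda>i. F (D i) b)"
        using alternates_shift by blast
      then show "\<exists>N m. \<forall>b\<in>B. \<not> alternates m (R n) (S n) N (\<lambda>i. F (D i) b)" by blast
    qed
  qed
  have "bounded_alternation B (\<lambda>i. F (D i))" unfolding bounded_alternation_def
  proof (intro allI impI)
    fix r s :: real assume "r < s"
    then obtain p where p: "r < of_rat p" "of_rat p < s" using of_rat_dense by blast
    obtain q where q: "of_rat p < (of_rat q :: real)" "of_rat q < s" using of_rat_dense[OF p(2)] by blast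
    define n where "n = to_nat (p, q)"
    have RS: "R n = of_rat p" "S n = of_rat q" by (simp_all add: n_def R_def S_def)
    then have "R n < S n" using q(1) by simp
    then obtain N m where Nm: "\<And>b. b \<in> B \<Longrightarrow> \<not> alternates m (R n) (S n) N (\<lambda>i. F (D i) b)"
      using P_diag[of n] unfolding P_def by blast
    have "\<not> alternates m r s N (\<lambda>i. F (D i) b)" if "b \<in> B" for b
    proof
      assume "alternates m r s N (\<lambda>i. F (D i) b)"
      then have "alternates m (R n) (S n) N (\<lambda>i. F (D i) b)"
        by (rule alternates_mono) (use p q RS in auto)
      then show False using Nm that by blast
    qed
    then show "\<exists>N n. \<forall>b\<in>B. \<not> alternates n r s N (\<lambda>i. F (D i) b)" by blast
  qed
  then show thesis using that subseq_diagseq unfolding D_def by blast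
qed

section \<open>The limit is a Baire-1/2 function\<close>

text \<open>
  Follow the sequence with hysteresis, beginning in the low state: it enters the high state when it
  passes above \<open>s\<close> and the low state when it passes below \<open>r\<close>. If \<open>M\<close> is the largest number of
  alternations, the last state is high exactly if \<open>M\<close> is odd, and the sum of \<open>(-1)\<^sup>m\<^sup>+\<^sup>1\<close> over
  \<open>1 \<le> m \<le> M\<close> is \<open>1\<close> or \<open>0\<close> accordingly.
\<close>

definition last_state :: "nat \<Rightarrow> real \<Rightarrow> real \<Rightarrow> nat \<Rightarrow> (nat \<Rightarrow> real) \<Rightarrow> real" where
  "last_state n r s N f = (\<Sum>m\<in>{1..N}. (if odd m then 1 else - 1) * of_bool (alternates n r s m f))"

text \<open>
  If the limit is above \<open>s\<close> and \<open>M\<close> were even, a late term would prolong the longest alternation; likewise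
  below \<open>r\<close>. For limits between \<open>r\<close> and \<open>s\<close> either state is possible.
\<close>

lemma last_state_limit:
  assumes bound: "\<not> alternates n r s N f" and lim: "f \<longlonglongrightarrow> l"
  shows "last_state n r s N f \<in> {0, 1}"
    and "s < l \<Longrightarrow> last_state n r s N f = 1" and "l < r \<Longrightarrow> last_state n r s N f = 0"
proof -
  define L where "L = (LEAST m. \<not> alternates n r s m f)"
  have L: "\<not> alternates n r s L f" "L \<le> N"
    unfolding L_def
    using bound LeastI[of "\<lambda>m. \<not> alternates n r s m f" N] Least_le[of "\<lambda>m. \<not> alternates n r s m f" N]
    by auto
  then obtain M where M: "L = Suc M" using alternates_0 by (cases L) auto
  have alt_M: "alternates n r s M f" using not_less_Least[of M "\<lambda>m. \<not> alternates n r s m f"] M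
    by (auto simp: L_def)
  have alt_iff: "alternates n r s m f \<longleftrightarrow> m \<le> M" for m
    using alternates_mono[OF alt_M, of n r s m] alternates_mono[of n r s m f n r s L] L(1) M
    by (cases "m \<le> M") auto
  have "last_state n r s N f = (\<Sum>m\<in>{1..N}. (if odd m then 1 else - 1) * of_bool (m \<le> M))"
    by (simp add: last_state_def alt_iff)
  also have "\<dots> = (\<Sum>m\<in>{1..M}. if odd m then 1 else - 1)"
    using L(2) M by (intro sum.mono_neutral_cong_right) auto
  also have "\<dots> = (if odd M then 1 else 0)" by (induction M) auto
  finally have eq: "last_state n r s N f = (if odd M then 1 else 0)" .
  then show "last_state n r s N f \<in> {0, 1}" by simp
  show "last_state n r s N f = 1" if "s < l"
  proof (rule ccontr)
    assume "last_state n r s N f \<noteq> 1"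
    then have "even M" using eq by (auto split: if_splits)
    obtain k0 where "\<And>k. k \<ge> k0 \<Longrightarrow> s < f k"
      using order_tendstoD(1)[OF lim \<open>s < l\<close>] by (auto simp: eventually_sequentially)
    then have "alternates n r s (Suc M) f"
      using \<open>even M\<close> by (intro alternates_Suc[OF alt_M]) (metis nle_le)
    then show False using L(1) M by simp
  qed
  show "last_state n r s N f = 0" if "l < r"
  proof (rule ccontr)
    assume "last_state n r s N f \<noteq> 0"
    then have "odd M" using eq by (auto split: if_splits)
    obtain k0 where "\<And>k. k \<ge> k0 \<Longrightarrow> f k < r"
      using order_tendstoD(2)[OF lim \<open>l < r\<close>] by (auto simp: eventually_sequentially)
    then have "alternates n r s (Suc M) f"
      using \<open>odd M\<close> by (intro alternates_Suc[OF alt_M]) (metis nle_le)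
    then show False using L(1) M by simp
  qed
qed

lemma openin_alternates:
  fixes F :: "nat \<Rightarrow> 'a \<Rightarrow> real"
  assumes gt: "\<And>i t. openin X {q \<in> topspace X. F i q > t}"
    and lt: "\<And>i t. openin X {q \<in> topspace X. F i q < t}"
  shows "openin X {q \<in> topspace X. alternates n r s m (\<lambda>i. F i q)}"
proof -
  define hit where "hit i k q \<longleftrightarrow> (if even k then s < F (i k) q else F (i k) q < r)"
    for i :: "nat \<Rightarrow> nat" and k q
  have hit: "openin X {q \<in> topspace X. hit i k q}" for i k
    using gt[of s "i k"] lt[of "i k" r] by (cases "even k") (simp_all add: hit_def gt lt)
  have "openin X {q \<in> topspace X. \<forall>k<m. hit i k q}" for i
  proof (induction m)
    case (Suc m)
    have "{q \<in> topspace X. \<forall>k<Suc m. hit i k q} =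
        {q \<in> topspace X. \<forall>k<m. hit i k q} \<inter> {q \<in> topspace X. hit i m q}"
      by (auto simp: less_Suc_eq)
    then show ?case using Suc hit by (simp add: openin_Int)
  qed simp
  then have "openin X (\<Union>i\<in>{i. strict_mono i \<and> n \<le> i 0}. {q \<in> topspace X. \<forall>k<m. hit i k q})"
    by blast
  moreover have "(\<Union>i\<in>{i. strict_mono i \<and> n \<le> i 0}. {q \<in> topspace X. \<forall>k<m. hit i k q}) =
      {q \<in> topspace X. alternates n r s m (\<lambda>i. F i q)}"
    unfolding alternates_def hit_def by blast
  ultimately show ?thesis by simp
qed

lemma semicontinuous_weighted_open_sets:
  fixes c :: "'z \<Rightarrow> real"
  assumes "finite Z" and c: "\<And>z. z \<in> Z \<Longrightarrow> 0 \<le> c z" and op: "\<And>z. z \<in> Z \<Longrightarrow> openin X (V z)"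
  shows "semicontinuous X (\<lambda>q. \<Sum>z\<in>Z. c z * of_bool (q \<in> V z))"
    and "bounded ((\<lambda>q. \<Sum>z\<in>Z. c z * of_bool (q \<in> V z)) ` topspace X)"
proof -
  let ?F = "\<lambda>q. \<Sum>z\<in>Z. c z * of_bool (q \<in> V z)"
  have "openin X {q \<in> topspace X. ?F q > t}" for t
  proof (subst openin_subopen, intro ballI)
    fix q assume q: "q \<in> {q \<in> topspace X. ?F q > t}"
    \<comment> \<open>On the intersection of all \<open>V z\<close> that contain \<open>q\<close> the sum is at least its value at \<open>q\<close>.\<close>
    define W where "W = {z \<in> Z. q \<in> V z}"
    define O' where "O' = (\<Inter>z\<in>W. V z) \<inter> topspace X"
    have "openin X O'" unfolding O'_def using assms(1) op by (intro openin_INT) (auto simp: W_def)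
    moreover have "q \<in> O'" using q by (auto simp: O'_def W_def)
    moreover have "?F q \<le> ?F p" if "p \<in> O'" for p
      using that c by (intro sum_mono mult_left_mono) (auto simp: O'_def W_def)
    then have "O' \<subseteq> {q \<in> topspace X. ?F q > t}" using q by (fastforce simp: O'_def)
    ultimately show "\<exists>T. openin X T \<and> q \<in> T \<and> T \<subseteq> {q \<in> topspace X. ?F q > t}" by blast
  qed
  then show "semicontinuous X ?F" by (simp add: semicontinuous_def)
  have "\<bar>?F q\<bar> \<le> (\<Sum>z\<in>Z. c z)" for q
  proof -
    have "\<bar>?F q\<bar> \<le> (\<Sum>z\<in>Z. \<bar>c z * of_bool (q \<in> V z)\<bar>)" by (rule sum_abs)
    also have "\<dots> \<le> (\<Sum>z\<in>Z. c z)" using c by (intro sum_mono) auto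
    finally show ?thesis .
  qed
  then show "bounded (?F ` topspace X)" by (intro boundedI[where B = "\<Sum>z\<in>Z. c z"]) auto
qed

text \<open>
  The state at a pair of neighbouring levels is determined by \<open>l\<close> unless \<open>l\<close> lies between the two, which
  happens for at most two pairs; the rest of the error comes from rounding \<open>l\<close> to the grid.
\<close>

lemma average_of_level_states:
  fixes c :: "nat \<Rightarrow> real"
  assumes "0 \<le> l" "l \<le> 1" and "K > 0"
    and c: "\<And>k. k < K \<Longrightarrow> c k \<in> {0, 1}"
    and hi: "\<And>k. k < K \<Longrightarrow> (real k + 1) / K < l \<Longrightarrow> c k = 1"
    and lo: "\<And>k. k < K \<Longrightarrow> l < real k / K \<Longrightarrow> c k = 0"
  shows "\<bar>(\<Sum>k<K. c k) / K - l\<bar> \<le> 2 / K"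
proof -
  define p where "p = nat \<lfloor>l * K\<rfloor>"
  have p: "real p \<le> l * K" "l * K < real p + 1" using assms(1) by (auto simp: p_def)
  have "l * K \<le> K" using assms(2) by (simp add: mult_left_le_one_le assms(1))
  then have pK: "p \<le> K" using p(1) by linarith
  have "real p - 1 \<le> real (p - 1)" by simp
  also have "\<dots> = (\<Sum>k<p - 1. 1 :: real)" by simp
  also have "\<dots> \<le> (\<Sum>k<p - 1. c k)"
  proof (intro sum_mono)
    fix k assume "k \<in> {..<p - 1}"
    then have k: "k < K" "real k + 1 < real p" using pK by auto
    then have "(real k + 1) / K < l" using p(1) assms(3) by (simp add: pos_divide_less_eq)
    then show "1 \<le> c k" using hi[OF k(1)] by simp
  qed
  also have "\<dots> \<le> (\<Sum>k<K. c k)" using pK c by (intro sum_mono2) fastforce+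
  finally have lower: "l * K - 2 \<le> (\<Sum>k<K. c k)" using p(2) by simp
  have "(\<Sum>k<K. c k) \<le> (\<Sum>k<K. of_bool (k < p + 1))"
  proof (intro sum_mono)
    fix k assume k: "k \<in> {..<K}"
    show "c k \<le> of_bool (k < p + 1)"
    proof (cases "k < p + 1")
      case True
      then show ?thesis using c[of k] k by auto
    next
      case False
      then have "l * K < real k" using p(2) by simp
      then have "l < real k / K" using assms(3) by (simp add: pos_less_divide_eq)
      then show ?thesis using lo[of k] k by simp
    qed
  qed
  also have "\<dots> = real (card ({..<K} \<inter> {k. k < p + 1}))" by (simp add: of_bool_def sum.If_cases)
  also have "\<dots> \<le> real (card {..<p + 1})" by (intro of_nat_mono card_mono) auto
  finally have upper: "(\<Sum>k<K. c k) \<le> l * K + 1" using p(1) by simp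
  have "\<bar>(\<Sum>k<K. c k) - l * K\<bar> \<le> 2" using lower upper by linarith
  then have "\<bar>(\<Sum>k<K. c k) - l * K\<bar> / K \<le> 2 / K" by (rule divide_right_mono) simp
  also have "\<bar>(\<Sum>k<K. c k) - l * K\<bar> / K = \<bar>((\<Sum>k<K. c k) - l * K) / K\<bar>" by simp
  also have "((\<Sum>k<K. c k) - l * K) / K = (\<Sum>k<K. c k) / K - l"
    using assms(3) by (simp add: diff_divide_distrib)
  finally show ?thesis .
qed

text \<open>
  For a grid of mesh \<open>1/K\<close> the average of the last states at neighbouring levels approximates the
  limit. It lies in \<open>DBSC\<close>: the sets where at least a given number of alternations occurs are open,
  and odd numbers are counted positively, even ones negatively.
\<close>

lemma Baire_half_limit:
  fixes F :: "nat \<Rightarrow> 'a \<Rightarrow> real"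
  assumes gt: "\<And>i t. openin X {q \<in> topspace X. F i q > t}"
    and lt: "\<And>i t. openin X {q \<in> topspace X. F i q < t}"
    and unit: "\<And>i q. q \<in> topspace X \<Longrightarrow> F i q \<in> {0..1}"
    and alt: "bounded_alternation (topspace X) F"
    and lim: "\<And>q. q \<in> topspace X \<Longrightarrow> (\<lambda>i. F i q) \<longlonglongrightarrow> f q"
  shows "Baire_half X f"
proof -
  have "\<exists>g. g \<in> DBSC X \<and> (\<forall>q\<in>topspace X. \<bar>g q - f q\<bar> \<le> 2 / real K)" if "K > 0" for K :: nat
  proof -
    have "\<exists>N n. \<forall>q\<in>topspace X. \<not> alternates n (k / K) ((k + 1) / K) N (\<lambda>i. F i q)" for k :: nat
      using alt \<open>K > 0\<close> unfolding bounded_alternation_def by (simp add: divide_strict_right_mono)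
    then obtain N n where Nn: "\<And>k q. q \<in> topspace X \<Longrightarrow>
        \<not> alternates (n k) (real k / K) ((real k + 1) / K) (N k) (\<lambda>i. F i q)"
      by (metis of_nat_1 of_nat_add)
    define V where "V = (\<lambda>(k, m). {q \<in> topspace X.
        alternates (n k) (real k / K) ((real k + 1) / K) m (\<lambda>i. F i q)})"
    define Z where "Z = (SIGMA k:{..<K}. {1..N k})"
    define F1 where "F1 q = (\<Sum>z\<in>Z. (if odd (snd z) then 1 / K else 0) * of_bool (q \<in> V z))" for q
    define F2 where "F2 q = (\<Sum>z\<in>Z. (if odd (snd z) then 0 else 1 / K) * of_bool (q \<in> V z))" for q
    have V: "openin X (V z)" for z
      unfolding V_def using openin_alternates[of X F, OF gt lt] by (simp split: prod.split)
    have Z: "finite Z" by (simp add: Z_def)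
    have "semicontinuous X F1" "bounded (F1 ` topspace X)" "semicontinuous X F2" "bounded (F2 ` topspace X)"
      unfolding F1_def F2_def
      by (intro semicontinuous_weighted_open_sets[OF Z _ V]; simp)+
    then have "(\<lambda>q. F1 q - F2 q) \<in> DBSC X" unfolding DBSC_def by blast
    moreover have "\<bar>(F1 q - F2 q) - f q\<bar> \<le> 2 / real K" if q: "q \<in> topspace X" for q
    proof -
      let ?c = "\<lambda>k. last_state (n k) (real k / K) ((real k + 1) / K) (N k) (\<lambda>i. F i q)"
      have V_iff: "q \<in> V (k, m) \<longleftrightarrow> alternates (n k) (real k / K) ((real k + 1) / K) m (\<lambda>i. F i q)"
        for k m by (simp add: V_def q)
      have "F1 q - F2 q = (\<Sum>z\<in>Z. (if odd (snd z) then 1 else - 1) * of_bool (q \<in> V z) / K)"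
        unfolding F1_def F2_def sum_subtractf[symmetric] by (intro sum.cong) auto
      also have "\<dots> = (\<Sum>k<K. \<Sum>m\<in>{1..N k}. (if odd m then 1 else - 1) * of_bool (q \<in> V (k, m)) / K)"
        unfolding Z_def by (subst sum.Sigma) (auto simp: case_prod_beta)
      also have "\<dots> = (\<Sum>k<K. ?c k / K)"
        by (simp only: last_state_def sum_divide_distrib V_iff)
      also have "\<dots> = (\<Sum>k<K. ?c k) / K" by (simp add: sum_divide_distrib)
      finally have eq: "F1 q - F2 q = (\<Sum>k<K. ?c k) / K" .
      have "0 \<le> f q" "f q \<le> 1"
        using unit[OF q] by (auto intro: LIMSEQ_le_const[OF lim[OF q]] LIMSEQ_le_const2[OF lim[OF q]])
      then show ?thesis unfolding eq
        using last_state_limit[OF Nn[OF q] lim[OF q]] \<open>K > 0\<close>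
        by (intro average_of_level_states) blast+
    qed
    ultimately show ?thesis by blast
  qed
  then have "\<exists>g. g \<in> DBSC X \<and> (\<forall>q\<in>topspace X. \<bar>g q - f q\<bar> \<le> 2 / real (Suc n))" for n by blast
  then obtain g where g: "\<And>n. g n \<in> DBSC X"
    "\<And>n q. q \<in> topspace X \<Longrightarrow> \<bar>g n q - f q\<bar> \<le> 2 / real (Suc n)" by metis
  have "uniform_limit (topspace X) g f sequentially"
  proof (rule uniform_limitI)
    fix e :: real assume "e > 0"
    have "(\<lambda>n. 2 / real (Suc n)) \<longlonglongrightarrow> 0"
      using tendsto_mult[OF tendsto_const[of 2] LIMSEQ_inverse_real_of_nat] by (simp add: field_simps)
    from order_tendstoD(2)[OF this \<open>e > 0\<close>]
    show "\<forall>\<^sub>F n in sequentially. \<forall>q\<in>topspace X. dist (g n q) (f q) < e"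
    proof eventually_elim
      case (elim n)
      then show ?case unfolding dist_real_def using g(2)[of _ n] by (meson le_less_trans)
    qed
  qed
  then show ?thesis using g(1) unfolding Baire_half_def by blast
qed

section \<open>Averages of increments\<close>

text \<open>Every increment in \<open>C\<close> passes both levels, so that high and low ends may be chosen in turn.\<close>

lemma alternates_if_crossings:
  assumes "finite C" and "\<And>i. i \<in> C \<Longrightarrow> (s < f (n + 2 * i) \<and> f (n + 2 * i + 1) < r) \<or>
      (f (n + 2 * i) < r \<and> s < f (n + 2 * i + 1))"
  shows "alternates n r s (card C) f"
proof -
  obtain e where e: "strict_mono_on {..<card C} e" "\<And>k. k < card C \<Longrightarrow> e k \<in> C"
    using finite_enumerate[OF assms(1)] by blast
  from strict_mono_on_extend[OF e(1)] obtain i where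
    i: "strict_mono i" "\<And>k. k < card C \<Longrightarrow> i k = e k" by blast
  have "\<exists>d\<le>1. k < card C \<longrightarrow> (if even k then s < f (n + 2 * i k + d) else f (n + 2 * i k + d) < r)" for k
    using assms(2)[of "i k"] i(2)[of k] e(2)[of k] by (metis add.right_neutral le_numeral_extra(4) zero_le)
  then obtain d where d: "\<And>k. d k \<le> (1 :: nat)" "\<And>k. k < card C \<Longrightarrow>
      (if even k then s < f (n + 2 * i k + d k) else f (n + 2 * i k + d k) < r)" by metis
  have "n + 2 * i k + d k < n + 2 * i (Suc k) + d (Suc k)" for k
    using strict_monoD[OF i(1), of k "Suc k"] d(1)[of k] by simp
  then have "strict_mono (\<lambda>k. n + 2 * i k + d k)" by (simp add: strict_mono_Suc_iff)
  then show ?thesis using d(2) unfolding alternates_def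
    by (intro exI[of _ "\<lambda>k. n + 2 * i k + d k"]) simp
qed

lemma levels_between:
  assumes "0 \<le> u" "v \<le> 1" and "K > 0" and "2 / real K < v - u"
  obtains k where "k < K" "u < real k / K" "(real k + 1) / K < v"
proof -
  define k where "k = nat \<lfloor>u * K\<rfloor> + 1"
  have k: "u * K < real k" "real k \<le> u * K + 1" using assms(1) by (auto simp: k_def) linarith
  have "2 < (v - u) * K" using assms(3,4) by (simp add: pos_divide_less_eq)
  then have vk: "real k + 1 < v * K" using k(2) by (simp add: algebra_simps)
  moreover have "v * real K \<le> 1 * real K" using assms(2) by (intro mult_right_mono) auto
  ultimately have "k < K" by linarith
  then show thesis
    using that[of k] k(1) vk assms(3) by (simp add: pos_less_divide_eq pos_divide_less_eq)
qed

text \<open>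
  A large increment crosses one of finitely many pairs of levels, which happens boundedly often;
  hence the averages of the increments tend to \<open>0\<close> uniformly.
\<close>

lemma small_average_increment:
  fixes F :: "nat \<Rightarrow> 'b \<Rightarrow> real"
  assumes alt: "bounded_alternation B F" and unit: "\<And>i b. b \<in> B \<Longrightarrow> F i b \<in> {0..1}" and "e > 0"
  shows "\<exists>n0. \<exists>n>0. \<forall>b\<in>B. (\<Sum>i<n. \<bar>F (n0 + 2 * i + 1) b - F (n0 + 2 * i) b\<bar>) \<le> e * real n"
proof -
  obtain K :: nat where K: "4 / e < real K" using reals_Archimedean2 by blast
  then have "K > 0" using \<open>e > 0\<close> by (cases K) auto
  have mesh: "2 / real K \<le> e / 2" using K \<open>e > 0\<close> \<open>K > 0\<close> by (simp add: field_simps)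
  have "\<exists>N n. \<forall>b\<in>B. \<not> alternates n (k / K) ((k + 1) / K) N (\<lambda>i. F i b)" for k :: nat
    using alt \<open>K > 0\<close> unfolding bounded_alternation_def by (simp add: divide_strict_right_mono)
  then obtain N m where Nm: "\<And>k b. b \<in> B \<Longrightarrow>
      \<not> alternates (m k) (real k / K) ((real k + 1) / K) (N k) (\<lambda>i. F i b)"
    by (metis of_nat_1 of_nat_add)
  \<comment> \<open>Any common upper bound of the \<open>m k\<close> would do as a starting point.\<close>
  define n0 where "n0 = (\<Sum>k<K. m k)"
  have n0: "m k \<le> n0" if "k < K" for k
    unfolding n0_def using that by (intro member_le_sum) auto
  define S where "S = (\<Sum>k<K. N k)"
  obtain n :: nat where n: "2 * real S / e < real n" using reals_Archimedean2 by blast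
  moreover have "0 \<le> 2 * real S / e"
    using \<open>e > 0\<close> by (intro divide_nonneg_pos mult_nonneg_nonneg) simp_all
  ultimately have "0 < real n" by linarith
  then have "n > 0" by simp
  have total: "real S \<le> e / 2 * real n" using n \<open>e > 0\<close> by (simp add: field_simps)
  show ?thesis
  proof (rule exI[of _ n0], rule exI[of _ n], intro conjI ballI)
    show "n > 0" by fact
    fix b assume b: "b \<in> B"
    define \<Delta> where "\<Delta> i = \<bar>F (n0 + 2 * i + 1) b - F (n0 + 2 * i) b\<bar>" for i
    define D where "D = {i. i < n \<and> 2 / K < \<Delta> i}"
    define C where "C k = {i. i < n \<and> (((real k + 1) / K < F (n0 + 2 * i) b \<and> F (n0 + 2 * i + 1) b < real k / K) \<or>
      (F (n0 + 2 * i) b < real k / K \<and> (real k + 1) / K < F (n0 + 2 * i + 1) b))}" for k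
    have card_C: "card (C k) \<le> N k" if "k < K" for k
    proof (rule ccontr)
      assume "\<not> card (C k) \<le> N k"
      moreover have "alternates n0 (real k / K) ((real k + 1) / K) (card (C k)) (\<lambda>i. F i b)"
        by (rule alternates_if_crossings) (auto simp: C_def)
      ultimately have "alternates (m k) (real k / K) ((real k + 1) / K) (N k) (\<lambda>i. F i b)"
        using n0[OF that] by (auto elim: alternates_mono)
      then show False using Nm b by blast
    qed
    have "D \<subseteq> (\<Union>k<K. C k)"
    proof
      fix i assume i: "i \<in> D"
      have u: "F j b \<in> {0..1}" for j using unit b by blast
      show "i \<in> (\<Union>k<K. C k)"
      proof (cases "F (n0 + 2 * i) b \<le> F (n0 + 2 * i + 1) b")
        case True
        then obtain k where "k < K" "F (n0 + 2 * i) b < real k / K" "(real k + 1) / K < F (n0 + 2 * i + 1) b"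
          using levels_between[of "F (n0 + 2 * i) b" "F (n0 + 2 * i + 1) b" K] u \<open>K > 0\<close> i
          by (auto simp: D_def \<Delta>_def)
        then show ?thesis using i by (auto simp: C_def D_def)
      next
        case False
        then obtain k where "k < K" "F (n0 + 2 * i + 1) b < real k / K" "(real k + 1) / K < F (n0 + 2 * i) b"
          using levels_between[of "F (n0 + 2 * i + 1) b" "F (n0 + 2 * i) b" K] u \<open>K > 0\<close> i
          by (auto simp: D_def \<Delta>_def)
        then show ?thesis using i by (auto simp: C_def D_def)
      qed
    qed
    then have "card D \<le> card (\<Union>k<K. C k)" by (intro card_mono) (auto simp: C_def)
    also have "\<dots> \<le> (\<Sum>k<K. card (C k))" by (rule card_UN_le) simp
    also have "\<dots> \<le> S" unfolding S_def using card_C by (intro sum_mono) auto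
    finally have card_D: "real (card D) \<le> e / 2 * real n" using total by linarith
    have "(\<Sum>i<n. \<Delta> i) \<le> (\<Sum>i<n. e / 2 + of_bool (i \<in> D))"
    proof (intro sum_mono)
      fix i assume i: "i \<in> {..<n}"
      have "F j b \<in> {0..1}" for j using unit b by blast
      from this[of "n0 + 2 * i"] this[of "n0 + 2 * i + 1"] have "\<Delta> i \<le> 1" by (auto simp: \<Delta>_def)
      then show "\<Delta> i \<le> e / 2 + of_bool (i \<in> D)"
        using i mesh \<open>e > 0\<close> by (cases "i \<in> D") (auto simp: D_def)
    qed
    also have "\<dots> = e / 2 * real n + real (card D)"
    proof -
      have "{..<n} \<inter> D = D" by (auto simp: D_def)
      then show ?thesis by (simp add: sum.distrib of_bool_def sum.If_cases)
    qed
    also have "\<dots> \<le> e * real n" using card_D by (simp add: field_simps)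
    finally show "(\<Sum>i<n. \<bar>F (n0 + 2 * i + 1) b - F (n0 + 2 * i) b\<bar>) \<le> e * real n"
      by (simp add: \<Delta>_def)
  qed
qed

section \<open>Consequences of NIP\<close>

text \<open>
  If for each \<open>N\<close> some sequence carries the alternating pattern of length \<open>N\<close> along all increasing
  indices, then by compactness there are rows each finite set of which is cut out by a column. Of the sequence only the terms \<open>3i + 1\<close> are
  kept: the pairs \<open>3i, 3i + 1\<close> and \<open>3i + 1, 3i + 2\<close> put such a term at an odd or at an even place of
  the pattern, as desired, independently for the various \<open>i\<close>.
\<close>

lemma NIP_imp_alternation_blocked:
  includes cardinal_syntax
  fixes M :: "('f, 'p, 'u) mstruct"
  assumes M: "is_structure L M" and sat: "saturated L \<kappa> M" and \<kappa>: "natLeq <o \<kappa>"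
    and pf: "partitioned_formula L \<phi> x y"
    and nip: "NIP M \<phi> x y" and "r < s"
  shows "\<exists>N. \<forall>a :: nat \<Rightarrow> 'u list. (\<forall>i. a i \<in> tuples (length x) (univ M)) \<longrightarrow>
    (\<exists>i. strict_mono i \<and> (\<forall>b\<in>tuples (length y) (univ M). \<not> pattern r s N (\<lambda>k. fm_val M \<phi> x y (a (i k)) b)))"
    (is "?goal")
proof (rule ccontr)
  assume "\<not> ?goal"
  then have ex: "\<exists>a :: nat \<Rightarrow> 'u list. (\<forall>i. a i \<in> tuples (length x) (univ M)) \<and> (\<forall>i. strict_mono i \<longrightarrow>
      (\<exists>b\<in>tuples (length y) (univ M). pattern r s N (\<lambda>k. fm_val M \<phi> x y (a (i k)) b)))" for N
    by meson
  \<comment> \<open>Column \<open>c\<close> is to cut out the finite set with code \<open>c\<close>; the bounds \<open>0\<close> and \<open>1\<close> impose nothing.\<close>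
  define lo hi :: "nat \<Rightarrow> nat \<Rightarrow> real" where "lo i c = (if i \<in> set_decode c then 0 else s)"
    and "hi i c = (if i \<in> set_decode c then r else 1)" for i c
  obtain a0 :: "nat \<Rightarrow> 'u list" where a0: "\<And>i. a0 i \<in> tuples (length x) (univ M)" using ex by metis
  have "\<exists>a b. (\<forall>i. a i \<in> tuples (length x) (univ M)) \<and>
      (\<forall>j. b j \<in> tuples (length y) (univ M)) \<and> (\<forall>i\<in>{}. a i = a0 i) \<and>
      (\<forall>i\<le>n. \<forall>j\<le>n. lo i j - 1 / (real n + 1) \<le> fm_val M \<phi> x y (a i) (b j) \<and>
                 fm_val M \<phi> x y (a i) (b j) \<le> hi i j + 1 / (real n + 1))" for n
  proof -
    obtain a :: "nat \<Rightarrow> 'u list" where a: "\<And>i. a i \<in> tuples (length x) (univ M)" "\<forall>i. strict_mono i \<longrightarrow>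
      (\<exists>b\<in>tuples (length y) (univ M). pattern r s (2 * (n + 1)) (\<lambda>k. fm_val M \<phi> x y (a (i k)) b))"
      using ex[of "2 * (n + 1)"] by (elim exE conjE) (rule that, simp_all)
    define ix where "ix c p = 3 * (p div 2) + p mod 2 + (if p div 2 \<in> set_decode c then 0 else 1)" for c p :: nat
    have "ix c p < ix c (Suc p)" for c p
      by (cases "even p") (auto elim!: evenE oddE simp: ix_def)
    then have "strict_mono (ix c)" for c by (simp add: strict_mono_Suc_iff)
    then have "\<forall>c. \<exists>b\<in>tuples (length y) (univ M). pattern r s (2 * (n + 1)) (\<lambda>k. fm_val M \<phi> x y (a (ix c k)) b)"
      using a(2) by simp
    then obtain b where b: "\<And>c. b c \<in> tuples (length y) (univ M)"
      "\<And>c. pattern r s (2 * (n + 1)) (\<lambda>k. fm_val M \<phi> x y (a (ix c k)) (b c))"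
      by metis
    have key: "lo i c \<le> fm_val M \<phi> x y (a (3 * i + 1)) (b c) \<and> fm_val M \<phi> x y (a (3 * i + 1)) (b c) \<le> hi i c"
      if "i \<le> n" for i c
    proof (cases "i \<in> set_decode c")
      case True
      then have "ix c (2 * i + 1) = 3 * i + 1" by (simp add: ix_def)
      then have "fm_val M \<phi> x y (a (3 * i + 1)) (b c) \<le> r"
        using b(2)[of c, unfolded pattern_def, rule_format, of "2 * i + 1"] that by simp
      then show ?thesis using True fm_val_in_unit[OF M pf a(1) b(1)] by (simp add: lo_def hi_def)
    next
      case False
      then have "ix c (2 * i) = 3 * i + 1" by (simp add: ix_def)
      then have "s \<le> fm_val M \<phi> x y (a (3 * i + 1)) (b c)"
        using b(2)[of c, unfolded pattern_def, rule_format, of "2 * i"] that by simp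
      then show ?thesis using False fm_val_in_unit[OF M pf a(1) b(1)] by (simp add: lo_def hi_def)
    qed
    have pos: "0 \<le> 1 / (real n + 1)" by simp
    have "lo i c - 1 / (real n + 1) \<le> fm_val M \<phi> x y (a (3 * i + 1)) (b c) \<and>
        fm_val M \<phi> x y (a (3 * i + 1)) (b c) \<le> hi i c + 1 / (real n + 1)" if "i \<le> n" for i c
      using key[OF that, of c] pos by linarith
    then show ?thesis using a(1) b(1)
      by (intro exI[of _ "\<lambda>i. a (3 * i + 1)"] exI[of _ b]) simp
  qed
  from realize_matrix[OF M sat \<kappa> pf a0 this] obtain a b where
    ab: "\<And>i. a i \<in> tuples (length x) (univ M)" "\<And>j. b j \<in> tuples (length y) (univ M)"
    "\<And>i j. fm_val M \<phi> x y (a i) (b j) \<in> {lo i j..hi i j}" by metis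
  have "IP M \<phi> x y" unfolding IP_def
  proof (rule exI[of _ r], rule exI[of _ s], intro conjI exI[of _ a] allI impI)
    fix E F :: "nat set" assume EF: "finite E \<and> finite F \<and> E \<inter> F = {}"
    have "fm_val M \<phi> x y (a i) (b (set_encode E)) \<le> r" if "i \<in> E" for i
      using ab(3)[of i "set_encode E"] that EF by (simp add: hi_def)
    moreover have "fm_val M \<phi> x y (a i) (b (set_encode E)) \<ge> s" if "i \<in> F" for i
      using ab(3)[of i "set_encode E"] that EF by (auto simp: lo_def split: if_splits)
    ultimately show "\<exists>b\<in>tuples (length y) (univ M).
        (\<forall>i\<in>E. fm_val M \<phi> x y (a i) b \<le> r) \<and> (\<forall>i\<in>F. fm_val M \<phi> x y (a i) b \<ge> s)"
      using ab(2) by blast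
  qed (use \<open>r < s\<close> ab(1) in auto)
  then show False using nip by (simp add: NIP_def)
qed

lemma NIP_imp_subseq_bounded_alternation:
  includes cardinal_syntax
  fixes M :: "('f, 'p, 'u) mstruct" and a :: "nat \<Rightarrow> 'u list"
  assumes "is_structure L M" "saturated L \<kappa> M" "natLeq <o \<kappa>" "partitioned_formula L \<phi> x y"
    and "NIP M \<phi> x y" and a: "\<And>i. a i \<in> tuples (length x) (univ M)"
  obtains j where "strict_mono j"
    "bounded_alternation (tuples (length y) (univ M)) (\<lambda>i b. fm_val M \<phi> x y (a (j i)) b)"
proof -
  have "\<exists>N. \<forall>j :: nat \<Rightarrow> nat. strict_mono j \<longrightarrow> (\<exists>i. strict_mono i \<and>
      (\<forall>b\<in>tuples (length y) (univ M). \<not> pattern r s N (\<lambda>k. fm_val M \<phi> x y (a (j (i k))) b)))"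
    if lt: "r < s" for r s
  proof -
    obtain N where N: "\<forall>a :: nat \<Rightarrow> 'u list. (\<forall>i. a i \<in> tuples (length x) (univ M)) \<longrightarrow>
      (\<exists>i. strict_mono i \<and> (\<forall>b\<in>tuples (length y) (univ M). \<not> pattern r s N (\<lambda>k. fm_val M \<phi> x y (a (i k)) b)))"
      using NIP_imp_alternation_blocked[OF assms(1-5) lt] by (elim exE)
    have "\<exists>i. strict_mono i \<and>
      (\<forall>b\<in>tuples (length y) (univ M). \<not> pattern r s N (\<lambda>k. fm_val M \<phi> x y (a (j (i k))) b))" for j :: "nat \<Rightarrow> nat"
      using N[THEN spec[of _ "\<lambda>i. a (j i)"]] a by simp
    then show ?thesis by (intro exI[of _ N] allI impI)
  qed
  from subseq_bounded_alternation[of "tuples (length y) (univ M)" "\<lambda>i b. fm_val M \<phi> x y (a i) b", OF this]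
  show thesis using that by blast
qed

text \<open>Types over any set take on a sequence of tuples the values of an element of the saturated structure.\<close>

lemma bounded_alternation_local_types:
  includes cardinal_syntax
  fixes M :: "('f, 'p, 'u) mstruct" and a :: "nat \<Rightarrow> 'u list"
  assumes "is_structure L M" "saturated L \<kappa> M" "natLeq <o \<kappa>" "partitioned_formula L \<phi> x y"
    and "A \<subseteq> univ M" and a: "\<And>i. a i \<in> tuples (length x) A"
    and alt: "bounded_alternation (tuples (length y) (univ M)) (\<lambda>i b. fm_val M \<phi> x y (a i) b)"
  shows "bounded_alternation (local_types L M \<phi> x y A) (\<lambda>i q. q (a i))"
  unfolding bounded_alternation_def
proof (intro allI impI)
  fix r s :: real assume "r < s"
  obtain N n where Nn: "\<And>b. b \<in> tuples (length y) (univ M) \<Longrightarrow>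
      \<not> alternates n r s N (\<lambda>i. fm_val M \<phi> x y (a i) b)"
    using bounded_alternationD[OF alt \<open>r < s\<close>] by metis
  have "\<not> alternates n r s N (\<lambda>i. q (a i))" if q: "q \<in> local_types L M \<phi> x y A" for q
  proof -
    obtain b where "b \<in> tuples (length y) (univ M)" "\<And>i. q (a i) = fm_val M \<phi> x y (a i) b"
      using local_type_realized[OF assms(1-5) q, of a] a by metis
    then show ?thesis using Nn by simp
  qed
  then show "\<exists>N n. \<forall>q\<in>local_types L M \<phi> x y A. \<not> alternates n r s N (\<lambda>i. q (a i))" by blast
qed

section \<open>Consequences of the independence property\<close>

lemma IP_witness:
  fixes M :: "('f, 'p, 'u) mstruct"
  assumes "IP M \<phi> x y"
  obtains r s and a :: "nat \<Rightarrow> 'u list" where "r < s" "\<And>i. a i \<in> tuples (length x) (univ M)"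
    "\<And>E F. finite E \<Longrightarrow> finite F \<Longrightarrow> E \<inter> F = {} \<Longrightarrow> \<exists>b\<in>tuples (length y) (univ M).
        (\<forall>i\<in>E. fm_val M \<phi> x y (a i) b \<le> r) \<and> (\<forall>i\<in>F. fm_val M \<phi> x y (a i) b \<ge> s)"
proof -
  obtain r s and a :: "nat \<Rightarrow> 'u list" where "r < s" "\<forall>i. a i \<in> tuples (length x) (univ M)"
    "\<forall>E F. finite E \<and> finite F \<and> E \<inter> F = {} \<longrightarrow> (\<exists>b\<in>tuples (length y) (univ M).
        (\<forall>i\<in>E. fm_val M \<phi> x y (a i) b \<le> r) \<and> (\<forall>i\<in>F. fm_val M \<phi> x y (a i) b \<ge> s))"
    using assms unfolding IP_def by (elim exE conjE) (rule that)
  then show thesis by (intro that[of r s a]) simp_all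
qed

text \<open>
  Shattering realizes each pattern on each finite set of indices, while blocking excludes, for every
  sequence, one pattern on at least one set of indices.
\<close>

lemma IP_imp_not_blocked:
  fixes M :: "('f, 'p, 'u) mstruct"
  assumes "IP M \<phi> x y"
  shows "\<not> semi_uniformly_blocked M \<phi> x y"
proof
  assume blocked: "semi_uniformly_blocked M \<phi> x y"
  obtain r s and a :: "nat \<Rightarrow> 'u list" where a: "r < s" "\<And>i. a i \<in> tuples (length x) (univ M)"
    "\<And>E F. finite E \<Longrightarrow> finite F \<Longrightarrow> E \<inter> F = {} \<Longrightarrow> \<exists>b\<in>tuples (length y) (univ M).
        (\<forall>i\<in>E. fm_val M \<phi> x y (a i) b \<le> r) \<and> (\<forall>i\<in>F. fm_val M \<phi> x y (a i) b \<ge> s)"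
    using IP_witness[OF assms] by metis
  from blocked[unfolded semi_uniformly_blocked_def, THEN spec, THEN spec, THEN mp, OF a(1)]
  obtain N E where E: "E \<subseteq> {1..N}" and all: "\<forall>a :: nat \<Rightarrow> 'u list. (\<forall>i. a i \<in> tuples (length x) (univ M)) \<longrightarrow>
      \<not> (\<forall>i :: nat \<Rightarrow> nat. strict_mono_on {1..N} i \<longrightarrow> (\<exists>b\<in>tuples (length y) (univ M).
        (\<forall>j\<in>E. fm_val M \<phi> x y (a (i j)) b \<le> r) \<and> (\<forall>j\<in>{1..N} - E. fm_val M \<phi> x y (a (i j)) b \<ge> s)))"
    by (elim exE conjE) (rule that)
  have "\<forall>i. a i \<in> tuples (length x) (univ M)" using a(2) by simp
  from all[THEN spec, THEN mp, OF this, unfolded not_all not_imp]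
  obtain i :: "nat \<Rightarrow> nat" where i: "strict_mono_on {1..N} i"
    "\<not> (\<exists>b\<in>tuples (length y) (univ M). (\<forall>j\<in>E. fm_val M \<phi> x y (a (i j)) b \<le> r) \<and>
        (\<forall>j\<in>{1..N} - E. fm_val M \<phi> x y (a (i j)) b \<ge> s))"
    by (elim exE conjE) (rule that)
  have "finite E" using E finite_subset by blast
  moreover have "i ` E \<inter> i ` ({1..N} - E) = {}"
    using E strict_mono_on_imp_inj_on[OF i(1)] by (auto simp: inj_on_def)
  ultimately show False using a(3)[of "i ` E" "i ` ({1..N} - E)"] i(2) by auto
qed

text \<open>
  Shattering provides, along a given subsequence, elements for longer and longer alternating patterns;
  compactness, with the sequence as parameters, provides one for the infinite pattern.
\<close>

lemma IP_imp_divergent_subseqs: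
  includes cardinal_syntax
  fixes M :: "('f, 'p, 'u) mstruct"
  assumes M: "is_structure L M" and sat: "saturated L \<kappa> M" and \<kappa>: "natLeq <o \<kappa>"
    and pf: "partitioned_formula L \<phi> x y" and "IP M \<phi> x y"
  obtains a :: "nat \<Rightarrow> 'u list" where "\<And>i. a i \<in> tuples (length x) (univ M)"
    and "\<And>j. strict_mono j \<Longrightarrow> \<exists>b\<in>tuples (length y) (univ M). \<not> convergent (\<lambda>i. fm_val M \<phi> x y (a (j i)) b)"
proof -
  obtain r s and a :: "nat \<Rightarrow> 'u list" where a: "r < s" "\<And>i. a i \<in> tuples (length x) (univ M)"
    "\<And>E F. finite E \<Longrightarrow> finite F \<Longrightarrow> E \<inter> F = {} \<Longrightarrow> \<exists>b\<in>tuples (length y) (univ M).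
        (\<forall>i\<in>E. fm_val M \<phi> x y (a i) b \<le> r) \<and> (\<forall>i\<in>F. fm_val M \<phi> x y (a i) b \<ge> s)"
    using IP_witness[OF assms(5)] by metis
  show thesis
  proof (rule that[of a, OF a(2)])
    fix j :: "nat \<Rightarrow> nat" assume j: "strict_mono j"
    define lo hi :: "nat \<Rightarrow> real" where "lo i = (if even i then 0 else s)"
      and "hi i = (if even i then r else 1)" for i
    have "\<exists>b\<in>tuples (length y) (univ M). \<forall>i\<le>n. lo i - 1 / (real n + 1) \<le> fm_val M \<phi> x y (a (j i)) b \<and>
        fm_val M \<phi> x y (a (j i)) b \<le> hi i + 1 / (real n + 1)" for n
    proof -
      have "j ` {i. i \<le> n \<and> even i} \<inter> j ` {i. i \<le> n \<and> odd i} = {}"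
        by (auto simp: strict_mono_eq[OF j])
      then obtain b where b: "b \<in> tuples (length y) (univ M)"
        "\<forall>i\<in>j ` {i. i \<le> n \<and> even i}. fm_val M \<phi> x y (a i) b \<le> r"
        "\<forall>i\<in>j ` {i. i \<le> n \<and> odd i}. fm_val M \<phi> x y (a i) b \<ge> s"
        using a(3)[of "j ` {i. i \<le> n \<and> even i}" "j ` {i. i \<le> n \<and> odd i}"] by auto
      have pos: "0 \<le> 1 / (real n + 1)" by simp
      have key: "lo i \<le> fm_val M \<phi> x y (a (j i)) b \<and> fm_val M \<phi> x y (a (j i)) b \<le> hi i"
        if "i \<le> n" for i
        using b(2,3) that fm_val_in_unit[OF M pf a(2) b(1)] by (auto simp: lo_def hi_def)
      have "lo i - 1 / (real n + 1) \<le> fm_val M \<phi> x y (a (j i)) b \<and>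
          fm_val M \<phi> x y (a (j i)) b \<le> hi i + 1 / (real n + 1)" if "i \<le> n" for i
        using key[OF that] pos by linarith
      then show ?thesis using b(1) by blast
    qed
    from realize_column[OF M sat \<kappa> pf a(2) this] obtain b where
      b: "b \<in> tuples (length y) (univ M)" "\<And>i. fm_val M \<phi> x y (a (j i)) b \<in> {lo i..hi i}" by metis
    have "\<not> convergent (\<lambda>i. fm_val M \<phi> x y (a (j i)) b)" (is "\<not> convergent ?f")
    proof
      assume "convergent ?f"
      then obtain l where l: "?f \<longlonglongrightarrow> l" by (auto simp: convergent_def)
      have "strict_mono (\<lambda>i :: nat. 2 * i)" "strict_mono (\<lambda>i :: nat. 2 * i + 1)"
        by (auto simp: strict_mono_def)
      note sub = this[THEN LIMSEQ_subseq_LIMSEQ[OF l], unfolded comp_def]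
      have "l \<le> r" using b(2)[of "2 * _"] by (intro LIMSEQ_le_const2[OF sub(1)]) (auto simp: hi_def)
      moreover have "s \<le> l" using b(2)[of "2 * _ + 1"] by (intro LIMSEQ_le_const[OF sub(2)]) (auto simp: lo_def)
      ultimately show False using \<open>r < s\<close> by simp
    qed
    then show "\<exists>b\<in>tuples (length y) (univ M). \<not> convergent (\<lambda>i. fm_val M \<phi> x y (a (j i)) b)"
      using b(1) by blast
  qed
qed

section \<open>Sequences equivalent to the unit basis of \<open>\<ell>\<^sub>1\<close>\<close>

lemma l1_norm_basis_combination:
  "l1_norm (\<lambda>z. \<Sum>i\<le>k. t i * l1_basis i z) = (\<Sum>i\<le>k. \<bar>t i\<bar>)"
proof -
  have eq: "(\<Sum>i\<le>k. t i * l1_basis i z) = (if z \<le> k then t z else 0)" for z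
    by (simp add: l1_basis_def if_distrib[of "\<lambda>u. _ * u"] cong: if_cong)
  have "(\<Sum>z. \<bar>if z \<le> k then t z else 0\<bar>) = (\<Sum>z\<le>k. \<bar>if z \<le> k then t z else 0\<bar>)"
    by (rule suminf_finite) auto
  then show ?thesis by (simp add: l1_norm_def eq)
qed

lemma abs_le_sup_norm:
  assumes "\<And>q. q \<in> topspace X \<Longrightarrow> \<bar>g q\<bar> \<le> c" and "p \<in> topspace X"
  shows "\<bar>g p\<bar> \<le> sup_norm X g"
  unfolding sup_norm_def using assms by (intro cSUP_upper bdd_aboveI2) auto

lemma sup_norm_le:
  assumes "\<And>q. q \<in> topspace X \<Longrightarrow> \<bar>g q\<bar> \<le> c" and "topspace X \<noteq> {}"
  shows "sup_norm X g \<le> c"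
  unfolding sup_norm_def using assms by (intro cSUP_least) auto

text \<open>
  Choose the element that makes the terms with positive coefficients large and the others small, and
  the element that does the opposite: the two values of a linear combination differ by at least
  \<open>(s - r) \<Sum> \<bar>t\<^sub>i\<bar>\<close>.
\<close>

lemma IP_imp_l1_sequence:
  fixes M :: "('f, 'p, 'u) mstruct"
  assumes M: "is_structure L M" and pf: "partitioned_formula L \<phi> x y" and "IP M \<phi> x y"
  obtains a :: "nat \<Rightarrow> 'u list" where "\<And>i. a i \<in> tuples (length x) (univ M)"
    and "equivalent_seqs (sup_norm (type_space L M \<phi> x y (univ M))) (\<lambda>i q. q (a i)) l1_norm l1_basis"
proof -
  obtain r s and a :: "nat \<Rightarrow> 'u list" where a: "r < s" "\<And>i. a i \<in> tuples (length x) (univ M)"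
    "\<And>E F. finite E \<Longrightarrow> finite F \<Longrightarrow> E \<inter> F = {} \<Longrightarrow> \<exists>b\<in>tuples (length y) (univ M).
        (\<forall>i\<in>E. fm_val M \<phi> x y (a i) b \<le> r) \<and> (\<forall>i\<in>F. fm_val M \<phi> x y (a i) b \<ge> s)"
    using IP_witness[OF assms(3)] by metis
  let ?X = "type_space L M \<phi> x y (univ M)"
  have realized: "\<exists>q\<in>topspace ?X. \<forall>i. q (a i) = fm_val M \<phi> x y (a i) b"
    if "b \<in> tuples (length y) (univ M)" for b
    using realized_local_type[OF M pf subset_refl that] a(2)
    by (intro bexI[of _ "\<lambda>a\<in>tuples (length x) (univ M). fm_val M \<phi> x y a b"]) (auto simp: topspace_type_space)
  have types: "\<exists>q\<in>topspace ?X. (\<forall>i\<in>E. q (a i) \<le> r) \<and> (\<forall>i\<in>F. q (a i) \<ge> s)"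
    if EF: "finite E" "finite F" "E \<inter> F = {}" for E F
  proof -
    obtain b where b: "b \<in> tuples (length y) (univ M)" "\<forall>i\<in>E. fm_val M \<phi> x y (a i) b \<le> r"
      "\<forall>i\<in>F. fm_val M \<phi> x y (a i) b \<ge> s" using a(3)[OF EF] by blast
    obtain q where "q \<in> topspace ?X" "\<And>i. q (a i) = fm_val M \<phi> x y (a i) b"
      using realized[OF b(1)] by blast
    then show ?thesis using b(2,3) by (intro bexI[of _ q]) auto
  qed
  have upper: "\<bar>\<Sum>i\<le>k. t i * q (a i)\<bar> \<le> (\<Sum>i\<le>k. \<bar>t i\<bar>)" if q: "q \<in> topspace ?X" for t k q
  proof -
    have "q (a i) \<in> {0..1}" for i
      using local_type_in_unit[OF pf subset_refl _ a(2)] q by (simp add: topspace_type_space)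
    then have "\<bar>t i * q (a i)\<bar> \<le> \<bar>t i\<bar>" for i by (simp add: abs_mult mult_left_le)
    then show ?thesis by (intro order_trans[OF sum_abs] sum_mono)
  qed
  have lower: "(s - r) / 2 * (\<Sum>i\<le>k. \<bar>t i\<bar>) \<le> sup_norm ?X (\<lambda>q. \<Sum>i\<le>k. t i * q (a i))" for k and t :: "nat \<Rightarrow> real"
  proof -
    let ?P = "{i. i \<le> k \<and> 0 < t i}" and ?N = "{i. i \<le> k \<and> t i \<le> 0}"
    have fin: "finite ?P" "finite ?N" "?P \<inter> ?N = {}" "?N \<inter> ?P = {}" by auto
    obtain p where p: "p \<in> topspace ?X" "\<forall>i\<in>?N. p (a i) \<le> r" "\<forall>i\<in>?P. p (a i) \<ge> s"
      using types[OF fin(2,1,4)] by blast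
    obtain q where q: "q \<in> topspace ?X" "\<forall>i\<in>?P. q (a i) \<le> r" "\<forall>i\<in>?N. q (a i) \<ge> s"
      using types[OF fin(1,2,3)] by blast
    have "(s - r) * \<bar>t i\<bar> \<le> t i * p (a i) - t i * q (a i)" if "i \<le> k" for i
    proof (cases "0 < t i")
      case True
      then have "s - r \<le> p (a i) - q (a i)" using p(3) q(2) that by (intro diff_mono) auto
      then have "(s - r) * t i \<le> (p (a i) - q (a i)) * t i" using True by (intro mult_right_mono) auto
      then show ?thesis using True by (simp add: algebra_simps)
    next
      case False
      then have "s - r \<le> q (a i) - p (a i)" using p(2) q(3) that by (intro diff_mono) auto
      then have "(s - r) * (- t i) \<le> (q (a i) - p (a i)) * (- t i)" using False by (intro mult_right_mono) auto
      then show ?thesis using False by (simp add: algebra_simps)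
    qed
    then have "(\<Sum>i\<le>k. (s - r) * \<bar>t i\<bar>) \<le> (\<Sum>i\<le>k. t i * p (a i) - t i * q (a i))"
      by (intro sum_mono) auto
    then have "(s - r) * (\<Sum>i\<le>k. \<bar>t i\<bar>) \<le> (\<Sum>i\<le>k. t i * p (a i)) - (\<Sum>i\<le>k. t i * q (a i))"
      by (simp add: sum_distrib_left sum_subtractf)
    moreover have "\<bar>\<Sum>i\<le>k. t i * p (a i)\<bar> \<le> sup_norm ?X (\<lambda>q. \<Sum>i\<le>k. t i * q (a i))"
      by (rule abs_le_sup_norm[OF upper p(1)])
    moreover have "\<bar>\<Sum>i\<le>k. t i * q (a i)\<bar> \<le> sup_norm ?X (\<lambda>q. \<Sum>i\<le>k. t i * q (a i))"
      by (rule abs_le_sup_norm[OF upper q(1)])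
    ultimately show ?thesis by (simp add: field_simps)
  qed
  have "topspace ?X \<noteq> {}" using types[of "{}" "{}"] by auto
  show thesis
  proof (rule that[OF a(2)])
    show "equivalent_seqs (sup_norm ?X) (\<lambda>i q. q (a i)) l1_norm l1_basis"
      unfolding equivalent_seqs_def l1_norm_basis_combination
    proof (rule exI[of _ "(s - r) / 2"], rule exI[of _ 1], intro conjI allI)
      fix k and t :: "nat \<Rightarrow> real"
      show "sup_norm ?X (\<lambda>q. \<Sum>i\<le>k. t i * q (a i)) \<le> 1 * (\<Sum>i\<le>k. \<bar>t i\<bar>)"
        using sup_norm_le[OF upper \<open>topspace ?X \<noteq> {}\<close>] by simp
    qed (use lower a(1) in auto)
  qed
qed

text \<open>
  On a subsequence with bounded alternation, averages of increments are small in the supremum norm,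
  whereas the increments \<open>e\<^sub>k - e\<^sub>l\<close> of the unit basis of \<open>\<ell>\<^sub>1\<close> have averages of norm \<open>2\<close>.
\<close>

lemma bounded_alternation_imp_not_l1:
  fixes f :: "nat \<Rightarrow> 'a \<Rightarrow> real"
  assumes ne: "topspace X \<noteq> {}" and unit: "\<And>i q. q \<in> topspace X \<Longrightarrow> f i q \<in> {0..1}"
    and j: "strict_mono j" and alt: "bounded_alternation (topspace X) (\<lambda>i. f (j i))"
  shows "\<not> equivalent_seqs (sup_norm X) f l1_norm l1_basis"
proof
  assume "equivalent_seqs (sup_norm X) f l1_norm l1_basis"
  then obtain c where c: "c > 0"
    "\<And>k t. c * (\<Sum>i\<le>k. \<bar>t i\<bar>) \<le> sup_norm X (\<lambda>q. \<Sum>i\<le>k. t i * f i q)"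
    unfolding equivalent_seqs_def l1_norm_basis_combination by blast
  have "\<exists>n0. \<exists>n>0. \<forall>q\<in>topspace X.
      (\<Sum>i<n. \<bar>f (j (n0 + 2 * i + 1)) q - f (j (n0 + 2 * i)) q\<bar>) \<le> c * real n"
    using unit by (intro small_average_increment alt c(1))
  then obtain n0 n where n: "n > 0" "\<forall>q\<in>topspace X.
      (\<Sum>i<n. \<bar>f (j (n0 + 2 * i + 1)) q - f (j (n0 + 2 * i)) q\<bar>) \<le> c * real n"
    by (elim exE conjE) (rule that)
  define k where "k = j (n0 + 2 * n)"
  \<comment> \<open>The coefficients of the sum of the increments over the pairs \<open>2i, 2i + 1\<close>.\<close>
  define t :: "nat \<Rightarrow> real" where
    "t l = (\<Sum>i<n. of_bool (l = j (n0 + 2 * i + 1)) - of_bool (l = j (n0 + 2 * i)))" for l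
  have le_k: "j (n0 + 2 * i + 1) \<le> k" "j (n0 + 2 * i) \<le> k" if "i < n" for i
    using that j by (auto simp: k_def strict_mono_less_eq)
  have pairing: "(\<Sum>l\<le>k. t l * w l) = (\<Sum>i<n. w (j (n0 + 2 * i + 1)) - w (j (n0 + 2 * i)))"
    for w :: "nat \<Rightarrow> real"
  proof -
    have "(\<Sum>l\<le>k. t l * w l) =
        (\<Sum>l\<le>k. \<Sum>i<n. (of_bool (l = j (n0 + 2 * i + 1)) - of_bool (l = j (n0 + 2 * i))) * w l)"
      by (simp add: t_def sum_distrib_right)
    also have "\<dots> = (\<Sum>i<n. \<Sum>l\<le>k. (of_bool (l = j (n0 + 2 * i + 1)) - of_bool (l = j (n0 + 2 * i))) * w l)"
      by (rule sum.swap)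
    also have "\<dots> = (\<Sum>i<n. w (j (n0 + 2 * i + 1)) - w (j (n0 + 2 * i)))"
    proof (intro sum.cong refl)
      fix i assume "i \<in> {..<n}"
      then have "i < n" by simp
      have single: "(\<Sum>l\<le>k. of_bool (l = m) * w l) = w m" if "m \<le> k" for m
        using that by (simp add: of_bool_def if_distrib[of "\<lambda>u. u * _"] cong: if_cong)
      show "(\<Sum>l\<le>k. (of_bool (l = j (n0 + 2 * i + 1)) - of_bool (l = j (n0 + 2 * i))) * w l) =
          w (j (n0 + 2 * i + 1)) - w (j (n0 + 2 * i))"
        unfolding left_diff_distrib sum_subtractf single[OF le_k(1)[OF \<open>i < n\<close>]]
          single[OF le_k(2)[OF \<open>i < n\<close>]] ..
    qed
    finally show ?thesis .
  qed
  \<comment> \<open>The norm of \<open>t\<close> is bounded below by pairing it with a sequence of signs.\<close>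
  define w :: "nat \<Rightarrow> real" where "w l = (if \<exists>i. l = j (n0 + 2 * i + 1) then 1 else - 1)" for l
  have "n0 + 2 * i \<noteq> n0 + 2 * i' + 1" for i i' by presburger
  then have "w (j (n0 + 2 * i)) = - 1" "w (j (n0 + 2 * i + 1)) = 1" for i
    by (auto simp: w_def strict_mono_eq[OF j])
  then have "2 * real n = (\<Sum>l\<le>k. t l * w l)" by (simp add: pairing)
  also have "\<dots> \<le> (\<Sum>l\<le>k. \<bar>t l\<bar>)" by (intro sum_mono) (auto simp: w_def)
  finally have "c * (2 * real n) \<le> c * (\<Sum>l\<le>k. \<bar>t l\<bar>)" using c(1) by simp
  also have "\<dots> \<le> sup_norm X (\<lambda>q. \<Sum>l\<le>k. t l * f l q)" by (rule c(2))
  also have "\<dots> \<le> c * real n"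
  proof (rule sup_norm_le[OF _ ne])
    fix q assume "q \<in> topspace X"
    then show "\<bar>\<Sum>l\<le>k. t l * f l q\<bar> \<le> c * real n"
      unfolding pairing using n(2) by (intro order_trans[OF sum_abs]) simp
  qed
  finally show False using c(1) n(1) by simp
qed

section \<open>The equivalences\<close>

theorem theorem4p5:
  fixes L :: "('f, 'p) lang" and T :: "('f, 'p) fm set" and \<kappa> :: "'k rel"
    and U :: "('f, 'p, 'u) mstruct" and \<phi> :: "('f, 'p) fm" and x y :: "nat list"
  assumes "is_language L"
    and "complete_theory TYPE('m) L T"
    and "monster_model L T \<kappa> U"
    and "partitioned_formula L \<phi> x y"
  shows
    "(NIP U \<phi> x y \<longleftrightarrow> semi_uniformly_blocked U \<phi> x y) \<and>
     (NIP U \<phi> x y \<longleftrightarrow>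
       (\<forall>a :: nat \<Rightarrow> 'u list. (\<forall>i. a i \<in> tuples (length x) (univ U)) \<longrightarrow>
         (\<exists>j :: nat \<Rightarrow> nat. strict_mono j \<and>
           (\<forall>b\<in>tuples (length y) (univ U). convergent (\<lambda>i. fm_val U \<phi> x y (a (j i)) b))))) \<and>
     (NIP U \<phi> x y \<longleftrightarrow>
       (\<forall>a :: nat \<Rightarrow> 'u list. (\<forall>i. a i \<in> tuples (length x) (univ U)) \<longrightarrow>
         (\<exists>(j :: nat \<Rightarrow> nat) f. strict_mono j \<and>
           (\<forall>q\<in>topspace (type_space L U \<phi> x y (\<Union>i. set (a i))).
              (\<lambda>i. q (a (j i))) \<longlonglongrightarrow> f q) \<and>
           Baire_half (type_space L U \<phi> x y (\<Union>i. set (a i))) f))) \<and>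
     (NIP U \<phi> x y \<longleftrightarrow>
       \<not> (\<exists>a :: nat \<Rightarrow> 'u list. (\<forall>i. a i \<in> tuples (length x) (univ U)) \<and>
           equivalent_seqs (sup_norm (type_space L U \<phi> x y (univ U))) (\<lambda>i q. q (a i))
             l1_norm l1_basis))"
    (is "(_ \<longleftrightarrow> _) \<and> (_ \<longleftrightarrow> ?conv) \<and> (_ \<longleftrightarrow> ?baire) \<and> (_ \<longleftrightarrow> ?no_l1)")
proof -
  have sat: "saturated L \<kappa> U" "(natLeq, \<kappa>) \<in> ordLess" and U: "is_structure L U"
    using assms(3) by (auto simp: monster_model_def is_model_def)
  note pf = assms(4)
  note monster = U sat pf
  have seq: "a i \<in> tuples (length x) (\<Union>i. set (a i))" "(\<Union>i. set (a i)) \<subseteq> univ U"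
    if "\<forall>i. a i \<in> tuples (length x) (univ U)" for a i
    using that by (auto simp: tuples_def)
  have unit: "fm_val U \<phi> x y a b \<in> {0..1}"
    if "a \<in> tuples (length x) (univ U)" "b \<in> tuples (length y) (univ U)" for a b
    by (rule fm_val_in_unit[OF U pf that])
  have blocked: "semi_uniformly_blocked U \<phi> x y" if nip: "NIP U \<phi> x y"
    unfolding semi_uniformly_blocked_def
  proof (intro allI impI)
    fix r s :: real assume "r < s"
    obtain N where N: "\<forall>a :: nat \<Rightarrow> 'u list. (\<forall>i. a i \<in> tuples (length x) (univ U)) \<longrightarrow>
      (\<exists>i. strict_mono i \<and> (\<forall>b\<in>tuples (length y) (univ U). \<not> pattern r s N (\<lambda>k. fm_val U \<phi> x y (a (i k)) b)))"
      using NIP_imp_alternation_blocked[OF monster nip \<open>r < s\<close>] by (elim exE)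
    let ?E = "{j \<in> {1..N}. even j}"
    have "\<not> (\<forall>i :: nat \<Rightarrow> nat. strict_mono_on {1..N} i \<longrightarrow> (\<exists>b\<in>tuples (length y) (univ U).
        (\<forall>j\<in>?E. fm_val U \<phi> x y (a (i j)) b \<le> r) \<and> (\<forall>j\<in>{1..N} - ?E. fm_val U \<phi> x y (a (i j)) b \<ge> s)))"
      (is "\<not> (\<forall>i. _ \<longrightarrow> ?realized i)") if a: "\<forall>i. a i \<in> tuples (length x) (univ U)" for a
    proof
      assume all: "\<forall>i. strict_mono_on {1..N} i \<longrightarrow> ?realized i"
      obtain i where i: "strict_mono i"
        "\<forall>b\<in>tuples (length y) (univ U). \<not> pattern r s N (\<lambda>k. fm_val U \<phi> x y (a (i k)) b)"
        using N[THEN spec[of _ a]] a by (elim impE exE conjE) simp_all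
      have "strict_mono_on {1..N} (\<lambda>j. i (j - 1))"
        using i(1) by (auto intro!: strict_mono_onI strict_monoD[of i])
      then obtain b where b: "b \<in> tuples (length y) (univ U)"
        "\<forall>j\<in>?E. fm_val U \<phi> x y (a (i (j - 1))) b \<le> r"
        "\<forall>j\<in>{1..N} - ?E. fm_val U \<phi> x y (a (i (j - 1))) b \<ge> s" using all by blast
      have "pattern r s N (\<lambda>k. fm_val U \<phi> x y (a (i k)) b)"
        unfolding pattern_def
      proof (intro allI impI)
        fix k assume "k < N"
        then show "if even k then s \<le> fm_val U \<phi> x y (a (i k)) b else fm_val U \<phi> x y (a (i k)) b \<le> r"
          using b(2)[rule_format, of "Suc k"] b(3)[rule_format, of "Suc k"] by auto
      qed
      then show False using i(2) b(1) by blast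
    qed
    then show "\<exists>N E. E \<subseteq> {1..N} \<and> (\<forall>a :: nat \<Rightarrow> 'u list. (\<forall>i. a i \<in> tuples (length x) (univ U)) \<longrightarrow>
        \<not> (\<forall>i :: nat \<Rightarrow> nat. strict_mono_on {1..N} i \<longrightarrow> (\<exists>b\<in>tuples (length y) (univ U).
          (\<forall>j\<in>E. fm_val U \<phi> x y (a (i j)) b \<le> r) \<and> (\<forall>j\<in>{1..N} - E. fm_val U \<phi> x y (a (i j)) b \<ge> s))))"
      by (intro exI[of _ N] exI[of _ ?E]) blast
  qed
  have conv: ?conv if nip: "NIP U \<phi> x y"
  proof (intro allI impI)
    fix a :: "nat \<Rightarrow> 'u list" assume a: "\<forall>i. a i \<in> tuples (length x) (univ U)"
    obtain j where j: "strict_mono j"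
      "bounded_alternation (tuples (length y) (univ U)) (\<lambda>i b. fm_val U \<phi> x y (a (j i)) b)"
      using NIP_imp_subseq_bounded_alternation[OF monster nip, of a] a by metis
    have "convergent (\<lambda>i. fm_val U \<phi> x y (a (j i)) b)" if "b \<in> tuples (length y) (univ U)" for b
      using j(2) unit a that unfolding bounded_alternation_def
      by (intro convergent_if_not_alternating) blast+
    then show "\<exists>j :: nat \<Rightarrow> nat. strict_mono j \<and>
        (\<forall>b\<in>tuples (length y) (univ U). convergent (\<lambda>i. fm_val U \<phi> x y (a (j i)) b))"
      using j(1) by blast
  qed
  have baire: ?baire if nip: "NIP U \<phi> x y"
  proof (intro allI impI)
    fix a :: "nat \<Rightarrow> 'u list" assume a: "\<forall>i. a i \<in> tuples (length x) (univ U)"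
    let ?A = "\<Union>i. set (a i)"
    let ?X = "type_space L U \<phi> x y ?A"
    obtain j where j: "strict_mono j"
      "bounded_alternation (tuples (length y) (univ U)) (\<lambda>i b. fm_val U \<phi> x y (a (j i)) b)"
      using NIP_imp_subseq_bounded_alternation[OF monster nip, of a] a by metis
    have alt: "bounded_alternation (topspace ?X) (\<lambda>i q. q (a (j i)))"
      unfolding topspace_type_space
      by (rule bounded_alternation_local_types[OF monster seq(2)[OF a] seq(1)[OF a] j(2)])
    have in_unit: "q (a (j i)) \<in> {0..1}" if "q \<in> topspace ?X" for q i
      using local_type_in_unit[OF pf seq(2)[OF a] _ seq(1)[OF a]] that by (simp add: topspace_type_space)
    define f where "f q = lim (\<lambda>i. q (a (j i)))" for q :: "'u list \<Rightarrow> real"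
    have f: "(\<lambda>i. q (a (j i))) \<longlonglongrightarrow> f q" if "q \<in> topspace ?X" for q
      unfolding f_def convergent_LIMSEQ_iff[symmetric]
      using alt in_unit[OF that] that unfolding bounded_alternation_def
      by (intro convergent_if_not_alternating) blast+
    have "Baire_half ?X f"
    proof (rule Baire_half_limit[where F = "\<lambda>i q. q (a (j i))"])
      show "openin ?X {q \<in> topspace ?X. q (a (j i)) > t}" "openin ?X {q \<in> topspace ?X. q (a (j i)) < t}"
        for i t unfolding topspace_type_space by (rule openin_type_space[OF seq(1)[OF a]])+
    qed (use in_unit alt f in \<open>blast+\<close>)
    then show "\<exists>(j :: nat \<Rightarrow> nat) f. strict_mono j \<and>
        (\<forall>q\<in>topspace ?X. (\<lambda>i. q (a (j i))) \<longlonglongrightarrow> f q) \<and> Baire_half ?X f"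
      using j(1) f by blast
  qed
  have no_l1: ?no_l1 if nip: "NIP U \<phi> x y"
  proof
    assume "\<exists>a :: nat \<Rightarrow> 'u list. (\<forall>i. a i \<in> tuples (length x) (univ U)) \<and>
        equivalent_seqs (sup_norm (type_space L U \<phi> x y (univ U))) (\<lambda>i q. q (a i)) l1_norm l1_basis"
    then obtain a :: "nat \<Rightarrow> 'u list" where a: "\<And>i. a i \<in> tuples (length x) (univ U)" and
      l1: "equivalent_seqs (sup_norm (type_space L U \<phi> x y (univ U))) (\<lambda>i q. q (a i)) l1_norm l1_basis"
      by blast
    obtain j where j: "strict_mono j"
      "bounded_alternation (tuples (length y) (univ U)) (\<lambda>i b. fm_val U \<phi> x y (a (j i)) b)"
      using NIP_imp_subseq_bounded_alternation[OF monster nip, of a] a by metis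
    have alt: "bounded_alternation (topspace (type_space L U \<phi> x y (univ U))) (\<lambda>i q. q (a (j i)))"
      unfolding topspace_type_space by (rule bounded_alternation_local_types[OF monster subset_refl a j(2)])
    obtain u where "u \<in> univ U" using U by (auto simp: is_structure_def)
    then have "replicate (length y) u \<in> tuples (length y) (univ U)" by (auto simp: tuples_def)
    then have "topspace (type_space L U \<phi> x y (univ U)) \<noteq> {}"
      using realized_local_type[OF U pf subset_refl] unfolding topspace_type_space by blast
    moreover have "q (a i) \<in> {0..1}" if "q \<in> topspace (type_space L U \<phi> x y (univ U))" for q i
      using local_type_in_unit[OF pf subset_refl _ a] that by (simp add: topspace_type_space)
    ultimately show False
      using bounded_alternation_imp_not_l1[of _ "\<lambda>i q. q (a i)" j] j(1) alt l1 by blast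
  qed
  have not_conv: "\<not> ?conv \<and> \<not> ?baire" if ip: "IP U \<phi> x y"
  proof -
    obtain a :: "nat \<Rightarrow> 'u list" where a: "\<And>i. a i \<in> tuples (length x) (univ U)"
      "\<And>j. strict_mono j \<Longrightarrow> \<exists>b\<in>tuples (length y) (univ U). \<not> convergent (\<lambda>i. fm_val U \<phi> x y (a (j i)) b)"
      using IP_imp_divergent_subseqs[OF monster ip] by metis
    have a': "\<forall>i. a i \<in> tuples (length x) (univ U)" using a(1) by simp
    have not_lim: "\<not> (\<forall>q\<in>topspace (type_space L U \<phi> x y (\<Union>i. set (a i))). (\<lambda>i. q (a (j i))) \<longlonglongrightarrow> f q)"
      if j: "strict_mono j" for j f
    proof
      assume lim: "\<forall>q\<in>topspace (type_space L U \<phi> x y (\<Union>i. set (a i))). (\<lambda>i. q (a (j i))) \<longlonglongrightarrow> f q"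
      obtain b where b: "b \<in> tuples (length y) (univ U)" "\<not> convergent (\<lambda>i. fm_val U \<phi> x y (a (j i)) b)"
        using a(2)[OF j] by blast
      let ?q = "\<lambda>a\<in>tuples (length x) (\<Union>i. set (a i)). fm_val U \<phi> x y a b"
      have "?q \<in> topspace (type_space L U \<phi> x y (\<Union>i. set (a i)))"
        unfolding topspace_type_space by (rule realized_local_type[OF U pf seq(2)[OF a'] b(1)])
      then have "(\<lambda>i. ?q (a (j i))) \<longlonglongrightarrow> f ?q" using lim by blast
      then have "convergent (\<lambda>i. fm_val U \<phi> x y (a (j i)) b)"
        using seq(1)[OF a'] by (auto simp: convergent_def)
      then show False using b(2) by blast
    qed
    show ?thesis
    proof (intro conjI notI)
      assume ?conv
      from this[THEN spec, THEN mp, OF a'] show False using a(2) by blast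
    next
      assume ?baire
      from this[THEN spec, THEN mp, OF a'] show False using not_lim by blast
    qed
  qed
  have l1: "\<not> ?no_l1" if ip: "IP U \<phi> x y"
  proof -
    obtain a :: "nat \<Rightarrow> 'u list" where "\<And>i. a i \<in> tuples (length x) (univ U)"
      "equivalent_seqs (sup_norm (type_space L U \<phi> x y (univ U))) (\<lambda>i q. q (a i)) l1_norm l1_basis"
      using IP_imp_l1_sequence[OF U pf ip] by metis
    then show ?thesis by blast
  qed
  have ip_iff: "IP U \<phi> x y \<longleftrightarrow> \<not> NIP U \<phi> x y" by (simp add: NIP_def)
  show ?thesis
  proof (intro conjI iffI blocked conv baire no_l1)
    show "NIP U \<phi> x y" if "semi_uniformly_blocked U \<phi> x y"
      using IP_imp_not_blocked that ip_iff by metis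
    show "NIP U \<phi> x y" if ?conv using not_conv ip_iff that by metis
    show "NIP U \<phi> x y" if ?baire using not_conv ip_iff that by metis
    show "NIP U \<phi> x y" if ?no_l1 using l1 ip_iff that by metis
  qed
qed

end
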